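(* Let $\Sigma=\{0,1\}^{\mathbb N}$, and for $\alpha,\theta\in[0,1]$ let $A_\alpha=\{\omega\in\Sigma:\lim_{n\to\infty}\frac1n\sum_{k=1}^n\omega_k\omega_{2k}=\alpha\}$, $E_\theta=\{\omega\in\Sigma:\lim_{n\to\infty}\frac{\omega_1+\cdots+\omega_n}{n}=\theta\}$, and $A=\{\omega\in\Sigma:\omega_k\omega_{2k}=0\text{ for all }k\ge1\}$. Then for $\alpha\le\theta\le(2+\alpha)/3$, $$h_{\rm top}(E_\theta\cap A_\alpha)=\Big(1-\frac\theta2\Big)H\Big(\frac{2\theta-\alpha}{2-\theta}\Big)+\frac\theta2H\Big(\frac{\theta-\alpha}{\theta}\Big)$$ (where the last term is interpreted as $0$ when $\theta=0$), and otherwise $E_\theta\cap A_\alpha=\emptyset$. Further, for $0\le\theta\le 2/3$, $$h_{\rm top}(E_\theta\cap A)=h_{\rm top}(E_\theta\cap A_0)=\frac{2-\theta}{2}H\Big(\frac{2\theta}{2-\theta}\Big).$$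
   Context: $\mathbb N=\{1,2,\dots\}$. $H(t)=-t\log t-(1-t)\log(1-t)$ with $H(0)=H(1)=0$. For $\omega\in\Sigma$ and $n\ge1$ let $C_n(\omega)=\{\tau\in\Sigma:\tau_i=\omega_i,\ 1\le i\le n\}$. For $E\subset\Sigma$ the (Bowen) topological entropy $h_{\rm top}(E)$ (for the left shift on $\Sigma$ with metric $d(\omega,\tau)=2^{-\min\{n\ge0:\omega_{n+1}\ne\tau_{n+1}\}}$) is: for $s\ge0$, $N\ge1$, $\mathcal H^s_N(E)=\inf\sum_i e^{-sn_i}$ over all finite or countable families of cylinders $C_{n_i}(x_i)$ with $n_i\ge N$ covering $E$; $\mathcal H^s(E)=\lim_{N\to\infty}\mathcal H^s_N(E)$; $h_{\rm top}(E)$ is the critical $s$ at which $\mathcal H^s(E)$ jumps from $+\infty$ to $0$. Equivalently $h_{\rm top}(E)=(\log2)\dim_H E$. *)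

theory Defs
  imports "HOL-Analysis.Analysis"
begin

text \<open>Sequences are indexed by \<open>{1, 2, \<dots>}\<close>; extensionality on this index set makes
  \<open>seq_space\<close> an exact copy of $\{0,1\}^{\mathbb N}$.\<close>

definition seq_space :: "(nat \<Rightarrow> nat) set" where
  "seq_space = {1..} \<rightarrow>\<^sub>E {0, 1}"

definition cylinder :: "nat \<Rightarrow> (nat \<Rightarrow> nat) \<Rightarrow> (nat \<Rightarrow> nat) set" where
  "cylinder n \<omega> = {\<tau> \<in> seq_space. \<forall>i\<in>{1..n}. \<tau> i = \<omega> i}"

text \<open>A finite or countable family is indexed by an arbitrary set \<open>I\<close> of naturals.\<close>

definition entropy_premeasure :: "real \<Rightarrow> nat \<Rightarrow> (nat \<Rightarrow> nat) set \<Rightarrow> ennreal" where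
  "entropy_premeasure s N E =
     Inf {\<Sum>\<^sub>\<infinity>i\<in>I. ennreal (exp (- s * real (n i))) |
            (I :: nat set) (n :: nat \<Rightarrow> nat) (x :: nat \<Rightarrow> nat \<Rightarrow> nat).
            (\<forall>i\<in>I. n i \<ge> N \<and> x i \<in> seq_space) \<and> E \<subseteq> (\<Union>i\<in>I. cylinder (n i) (x i))}"

definition entropy_measure :: "real \<Rightarrow> (nat \<Rightarrow> nat) set \<Rightarrow> ennreal" where
  "entropy_measure s E = lim (\<lambda>N. entropy_premeasure s N E)"

text \<open>The critical exponent; that it is one is shown in \<open>entropy_measure_above\<close> and
  \<open>entropy_measure_below\<close>.\<close>

definition h_top :: "(nat \<Rightarrow> nat) set \<Rightarrow> real" where
  "h_top E = Inf {s. 0 \<le> s \<and> entropy_measure s E = 0}"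

definition bin_entropy :: "real \<Rightarrow> real" where
  "bin_entropy t = (if t = 0 \<or> t = 1 then 0 else - t * ln t - (1 - t) * ln (1 - t))"

definition mult_avg_set :: "real \<Rightarrow> (nat \<Rightarrow> nat) set" where
  "mult_avg_set \<alpha> =
     {\<omega> \<in> seq_space. (\<lambda>n. (\<Sum>k=1..n. real (\<omega> k * \<omega> (2 * k))) / real n) \<longlonglongrightarrow> \<alpha>}"

definition freq_set :: "real \<Rightarrow> (nat \<Rightarrow> nat) set" where
  "freq_set \<theta> = {\<omega> \<in> seq_space. (\<lambda>n. (\<Sum>k=1..n. real (\<omega> k)) / real n) \<longlonglongrightarrow> \<theta>}"

definition mult_golden_set :: "(nat \<Rightarrow> nat) set" where
  "mult_golden_set = {\<omega> \<in> seq_space. \<forall>k\<ge>1. \<omega> k * \<omega> (2 * k) = 0}"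


lemma entropy_premeasure_mono:
  assumes "M \<le> N"
  shows "entropy_premeasure s M E \<le> entropy_premeasure s N E"
  unfolding entropy_premeasure_def
  by (rule Inf_superset_mono) (use order_trans[OF assms] in blast)

lemma entropy_premeasure_tendsto:
  "(\<lambda>N. entropy_premeasure s N E) \<longlonglongrightarrow> entropy_measure s E"
proof -
  have "(\<lambda>N. entropy_premeasure s N E) \<longlonglongrightarrow> (SUP N. entropy_premeasure s N E)"
    by (rule LIMSEQ_SUP) (simp add: incseq_def entropy_premeasure_mono)
  then show ?thesis
    unfolding entropy_measure_def using limI by metis
qed

lemma entropy_premeasure_le_measure: "entropy_premeasure s N E \<le> entropy_measure s E"
  by (rule incseq_le[OF _ entropy_premeasure_tendsto])
    (simp add: incseq_def entropy_premeasure_mono)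

lemma entropy_premeasure_shift:
  assumes "s \<le> t"
  shows "entropy_premeasure t N E \<le> ennreal (exp (- (t - s) * real N)) * entropy_premeasure s N E"
proof -
  let ?c = "exp (- (t - s) * real N)"
  have cover: "ennreal (1 / ?c) * entropy_premeasure t N E
      \<le> (\<Sum>\<^sub>\<infinity>i\<in>I. ennreal (exp (- s * real (n i))))"
    if *: "\<forall>i\<in>I. n i \<ge> N \<and> x i \<in> seq_space" "E \<subseteq> (\<Union>i\<in>I. cylinder (n i) (x i))"
    for I :: "nat set" and n :: "nat \<Rightarrow> nat" and x :: "nat \<Rightarrow> nat \<Rightarrow> nat"
  proof -
    have "entropy_premeasure t N E \<le> (\<Sum>\<^sub>\<infinity>i\<in>I. ennreal (exp (- t * real (n i))))"
      unfolding entropy_premeasure_def by (rule Inf_lower) (use * in blast)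
    also have "\<dots> \<le> ennreal ?c * (\<Sum>\<^sub>\<infinity>i\<in>I. ennreal (exp (- s * real (n i))))"
      unfolding nonneg_infsum_complete[of I "\<lambda>i. ennreal (exp (- t * real (n i)))", OF zero_le]
    proof (rule SUP_least)
      fix F assume F: "F \<in> {F. finite F \<and> F \<subseteq> I}"
      have "(\<Sum>i\<in>F. ennreal (exp (- t * real (n i))))
          \<le> (\<Sum>i\<in>F. ennreal ?c * ennreal (exp (- s * real (n i))))"
      proof (rule sum_mono)
        fix i assume "i \<in> F"
        then have "real N \<le> real (n i)" using F * by auto
        then have "(t - s) * real N \<le> (t - s) * real (n i)"
          using assms by (intro mult_left_mono) auto
        then have "exp (- t * real (n i)) \<le> ?c * exp (- s * real (n i))"
          by (simp flip: exp_add add: algebra_simps)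
        then show "ennreal (exp (- t * real (n i))) \<le> ennreal ?c * ennreal (exp (- s * real (n i)))"
          by (simp flip: ennreal_mult)
      qed
      also have "\<dots> = ennreal ?c * (\<Sum>i\<in>F. ennreal (exp (- s * real (n i))))"
        by (rule sum_distrib_left[symmetric])
      also have "\<dots> \<le> ennreal ?c * (\<Sum>\<^sub>\<infinity>i\<in>I. ennreal (exp (- s * real (n i))))"
        unfolding nonneg_infsum_complete[of I "\<lambda>i. ennreal (exp (- s * real (n i)))", OF zero_le]
        by (intro mult_left_mono SUP_upper) (use F in auto)
      finally show "(\<Sum>i\<in>F. ennreal (exp (- t * real (n i))))
          \<le> ennreal ?c * (\<Sum>\<^sub>\<infinity>i\<in>I. ennreal (exp (- s * real (n i))))" .
    qed
    finally have "ennreal (1 / ?c) * entropy_premeasure t N E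
        \<le> ennreal (1 / ?c) * (ennreal ?c * (\<Sum>\<^sub>\<infinity>i\<in>I. ennreal (exp (- s * real (n i)))))"
      by (rule mult_left_mono) simp
    also have "\<dots> = (\<Sum>\<^sub>\<infinity>i\<in>I. ennreal (exp (- s * real (n i))))"
      by (simp flip: mult.assoc ennreal_mult)
    finally show ?thesis .
  qed
  have "ennreal (1 / ?c) * entropy_premeasure t N E \<le> entropy_premeasure s N E"
    unfolding entropy_premeasure_def[of s] by (rule Inf_greatest) (use cover in blast)
  then have "ennreal ?c * (ennreal (1 / ?c) * entropy_premeasure t N E)
      \<le> ennreal ?c * entropy_premeasure s N E"
    by (rule mult_left_mono) simp
  then show ?thesis
    by (simp flip: mult.assoc ennreal_mult)
qed

lemma entropy_measure_jump:
  assumes "s < t" and "entropy_measure s E < \<infinity>"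
  shows "entropy_measure t E = 0"
proof -
  obtain r where r: "entropy_measure s E = ennreal r" "0 \<le> r"
    using assms(2) by (cases "entropy_measure s E") auto
  have le: "entropy_premeasure t N E \<le> ennreal (exp (- (t - s) * real N) * r)" for N
  proof -
    have "entropy_premeasure t N E
        \<le> ennreal (exp (- (t - s) * real N)) * entropy_premeasure s N E"
      using assms(1) by (intro entropy_premeasure_shift) simp
    also have "\<dots> \<le> ennreal (exp (- (t - s) * real N)) * ennreal r"
      unfolding r(1)[symmetric] by (intro mult_left_mono entropy_premeasure_le_measure) simp
    finally show ?thesis using r(2) by (simp add: ennreal_mult)
  qed
  have "exp (- (t - s)) < 1" using assms(1) by simp
  then have "(\<lambda>N. exp (- (t - s)) ^ N * r) \<longlonglongrightarrow> 0 * r"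
    by (intro tendsto_intros LIMSEQ_realpow_zero) auto
  then have "(\<lambda>N. exp (- (t - s) * real N) * r) \<longlonglongrightarrow> 0"
    by (simp flip: exp_of_nat_mult add: mult.commute)
  then have "(\<lambda>N. ennreal (exp (- (t - s) * real N) * r)) \<longlonglongrightarrow> ennreal 0"
    by (rule tendsto_ennrealI)
  then have "entropy_measure t E \<le> ennreal 0"
    by (rule LIMSEQ_le[OF entropy_premeasure_tendsto]) (use le in auto)
  then show ?thesis by simp
qed

lemma entropy_premeasure_le_words:
  assumes "E \<subseteq> seq_space"
  shows "entropy_premeasure s N E \<le> ennreal (2 ^ N * exp (- s * real N))"
proof -
  define W where "W = ({1..N} \<rightarrow>\<^sub>E {0, 1} :: (nat \<Rightarrow> nat) set)"
  have finW: "finite W" unfolding W_def by (intro finite_PiE) auto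
  have cardW: "card W = 2 ^ N" unfolding W_def by (simp add: card_PiE card_insert_if numeral_2_eq_2)
  obtain f where f: "bij_betw f {..<(2::nat) ^ N} W"
    using ex_bij_betw_nat_finite[OF finW] cardW by (auto simp: atLeast0LessThan)
  define x where "x i = (\<lambda>k\<in>{1..}. if k \<le> N then f i k else 0)" for i
  have x: "x i \<in> seq_space" if "i < 2 ^ N" for i
  proof -
    have "f i \<in> W" using f that by (auto simp: bij_betw_def)
    then have "f i k \<in> {0, 1}" if "1 \<le> k" "k \<le> N" for k
      using PiE_mem[of "f i" "{1..N}" "\<lambda>_. {0, 1}" k] that unfolding W_def by simp
    then show ?thesis unfolding x_def seq_space_def by (intro restrict_PiE_iff[THEN iffD2]) auto
  qed
  have "E \<subseteq> (\<Union>i\<in>{..<2 ^ N}. cylinder N (x i))"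
  proof
    fix \<omega> assume "\<omega> \<in> E"
    then have \<omega>: "\<omega> \<in> seq_space" using assms by blast
    then have "restrict \<omega> {1..N} \<in> W"
      unfolding W_def seq_space_def by (auto simp: PiE_iff)
    then obtain i where i: "i < 2 ^ N" "f i = restrict \<omega> {1..N}"
      unfolding bij_betw_imp_surj_on[OF f, symmetric] by (auto simp: image_iff)
    then have "\<omega> \<in> cylinder N (x i)"
      using \<omega> unfolding cylinder_def x_def by auto
    then show "\<omega> \<in> (\<Union>i\<in>{..<2 ^ N}. cylinder N (x i))" using i by auto
  qed
  then have "entropy_premeasure s N E \<le> (\<Sum>\<^sub>\<infinity>i\<in>{..<(2::nat) ^ N}. ennreal (exp (- s * real N)))"
    unfolding entropy_premeasure_def
    by (intro Inf_lower CollectI exI[of _ "{..<(2::nat) ^ N}"] exI[of _ "\<lambda>_. N"] exI[of _ x])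
      (use x in auto)
  also have "\<dots> = ennreal (2 ^ N * exp (- s * real N))"
    by (simp add: ennreal_mult flip: ennreal_power)
  finally show ?thesis .
qed

lemma entropy_measure_one:
  assumes "E \<subseteq> seq_space"
  shows "entropy_measure 1 E = 0"
proof -
  have "2 < exp (1::real)" using exp_lower_Taylor_quadratic[of "1::real"] by simp
  then have "(\<lambda>N. (2 * exp (- 1)) ^ N) \<longlonglongrightarrow> (0::real)"
    by (intro LIMSEQ_realpow_zero) (auto simp: exp_minus field_simps)
  then have "(\<lambda>N. ennreal (2 ^ N * exp (- 1 * real N))) \<longlonglongrightarrow> ennreal 0"
    by (intro tendsto_ennrealI)
      (simp add: power_mult_distrib flip: exp_of_nat_mult)
  then have "entropy_measure 1 E \<le> ennreal 0"
    by (rule LIMSEQ_le[OF entropy_premeasure_tendsto])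
      (use entropy_premeasure_le_words[OF assms] in blast)
  then show ?thesis by simp
qed

lemma entropy_measure_above:
  assumes "E \<subseteq> seq_space" and "h_top E < s"
  shows "entropy_measure s E = 0"
proof -
  have "{s. 0 \<le> s \<and> entropy_measure s E = 0} \<noteq> {}"
    using entropy_measure_one[OF assms(1)] zero_le_one by blast
  then obtain r where "r \<in> {s. 0 \<le> s \<and> entropy_measure s E = 0}" "r < s"
    using assms(2) unfolding h_top_def by (rule cInf_lessD[THEN bexE])
  then show ?thesis using entropy_measure_jump[of r s E] by simp
qed

lemma entropy_measure_below:
  assumes "0 \<le> s" and "s < h_top E"
  shows "entropy_measure s E = \<infinity>"
proof (rule ccontr)
  assume "entropy_measure s E \<noteq> \<infinity>"
  then have fin: "entropy_measure s E < \<infinity>" by (simp add: less_top)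
  obtain t where t: "s < t" "t < h_top E" using assms(2) dense by blast
  have "entropy_measure t E = 0" using entropy_measure_jump[OF t(1) fin] .
  then have "h_top E \<le> t"
    unfolding h_top_def using t(1) assms(1) by (intro cInf_lower bdd_belowI[of _ 0]) auto
  then show False using t(2) by simp
qed

end

theory Submission
  imports Defs "HOL-Probability.Infinite_Product_Measure" "HOL-Probability.Probability_Mass_Function"
begin

text \<open>
  Let \<open>\<mu>\<close> be the law of the random sequence whose \<open>k\<close>-th bit is 1 with probability \<open>q\<close> if
  \<open>k\<close> is even and bit \<open>k / 2\<close> is 1, and with probability \<open>p\<close> otherwise. The logarithm of the
  mass of a cylinder of length \<open>n\<close> is linear in the number of ones up to \<open>n\<close> and up to
  \<open>n / 2\<close> and in the number of pairs \<open>\<omega> k = \<omega> (2 * k) = 1\<close> with \<open>k \<le> n / 2\<close>. So on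
  \<open>E\<^sub>\<theta> \<inter> A\<^sub>\<alpha>\<close> the local entropy \<open>- ln (\<mu> (C\<^sub>n \<omega>)) / n\<close> converges to the same value at
  every point. With \<open>p, q\<close> in the open unit interval, arbitrarily close to the optimal
  \<open>p = (2 * \<theta> - \<alpha>) / (2 - \<theta>)\<close> and \<open>q = \<alpha> / \<theta>\<close>, this gives the upper bound by counting
  heavy cylinders. For the optimal \<open>p, q\<close> the measure is carried by \<open>E\<^sub>\<theta> \<inter> A\<^sub>\<alpha>\<close>, which
  gives the lower bound by the mass distribution principle. The law of large numbers needed here
  comes from comparing \<open>\<mu>\<close> with the same kind of measure for slightly tilted \<open>p, q\<close>.
  For \<open>\<alpha> = 0\<close> one has \<open>q = 0\<close>, and the measure is even carried by \<open>E\<^sub>\<theta> \<inter> A\<close>.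
\<close>

subsection \<open>Cylinders\<close>

lemma seq_space_values: "\<omega> \<in> seq_space \<Longrightarrow> 1 \<le> k \<Longrightarrow> \<omega> k = 0 \<or> \<omega> k = 1"
  unfolding seq_space_def by (force simp: PiE_iff)

text \<open>A word of length \<open>n\<close> is represented by its extension by zeros, so that it
  is itself a point of \<open>seq_space\<close> and can be the centre of a cylinder.\<close>

definition truncate_seq :: "nat \<Rightarrow> (nat \<Rightarrow> nat) \<Rightarrow> nat \<Rightarrow> nat" where
  "truncate_seq n \<omega> = (\<lambda>k\<in>{1..}. if k \<le> n then \<omega> k else 0)"

definition seq_words :: "nat \<Rightarrow> (nat \<Rightarrow> nat) set" where
  "seq_words n = truncate_seq n ` seq_space"

lemma truncate_seq_in_space: "\<omega> \<in> seq_space \<Longrightarrow> truncate_seq n \<omega> \<in> seq_space"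
  unfolding truncate_seq_def seq_space_def by (auto simp: PiE_iff)

lemma truncate_seq_in_cylinder: "\<omega> \<in> seq_space \<Longrightarrow> truncate_seq n \<omega> \<in> cylinder n \<omega>"
  using truncate_seq_in_space[of \<omega> n] unfolding cylinder_def by (auto simp: truncate_seq_def)

lemma in_cylinder_truncate_seq: "\<omega> \<in> seq_space \<Longrightarrow> \<omega> \<in> cylinder n (truncate_seq n \<omega>)"
  unfolding cylinder_def by (auto simp: truncate_seq_def)

lemma cylinder_subset: "cylinder n \<omega> \<subseteq> seq_space"
  by (auto simp: cylinder_def)

lemma seq_words_subset: "seq_words n \<subseteq> seq_space"
  unfolding seq_words_def using truncate_seq_in_space by blast

lemma truncate_seq_of_cylinder:
  assumes "w \<in> seq_words n" and "\<tau> \<in> cylinder n w"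
  shows "truncate_seq n \<tau> = w"
  using assms unfolding seq_words_def cylinder_def truncate_seq_def by (auto simp: fun_eq_iff)

lemma finite_seq_words: "finite (seq_words n)"
proof -
  have "seq_words n \<subseteq> truncate_seq n ` ({1..n} \<rightarrow>\<^sub>E {0, 1})"
  proof
    fix w assume "w \<in> seq_words n"
    then obtain \<omega> where \<omega>: "\<omega> \<in> seq_space" "w = truncate_seq n \<omega>" by (auto simp: seq_words_def)
    have "w = truncate_seq n (restrict \<omega> {1..n})"
      unfolding \<omega>(2) by (auto simp: truncate_seq_def fun_eq_iff)
    moreover have "restrict \<omega> {1..n} \<in> {1..n} \<rightarrow>\<^sub>E {0, 1}"
      using seq_space_values[OF \<omega>(1)] by auto
    ultimately show "w \<in> truncate_seq n ` ({1..n} \<rightarrow>\<^sub>E {0, 1})" by blast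
  qed
  then show ?thesis by (rule finite_subset) (intro finite_imageI finite_PiE, auto)
qed

lemma disjoint_cylinders: "disjoint_family_on (cylinder n) (seq_words n)"
  unfolding disjoint_family_on_def using truncate_seq_of_cylinder by (metis disjoint_iff)

text \<open>The second hypothesis says that membership in \<open>A\<close> depends on the first
  \<open>n\<close> coordinates only, so \<open>A\<close> contains the truncations of its points. The
  measure of such an event becomes a finite sum over words.\<close>

lemma determined_eq_Union_cylinders:
  assumes "A \<subseteq> seq_space" and "\<And>\<omega>. \<omega> \<in> A \<Longrightarrow> cylinder n \<omega> \<subseteq> A"
  shows "A = (\<Union>w\<in>seq_words n \<inter> A. cylinder n w)"
proof
  show "A \<subseteq> (\<Union>w\<in>seq_words n \<inter> A. cylinder n w)"
  proof
    fix \<omega> assume "\<omega> \<in> A"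
    then have "\<omega> \<in> seq_space" "truncate_seq n \<omega> \<in> A"
      using assms truncate_seq_in_cylinder by blast+
    then show "\<omega> \<in> (\<Union>w\<in>seq_words n \<inter> A. cylinder n w)"
      using in_cylinder_truncate_seq by (auto simp: seq_words_def)
  qed
qed (use assms in blast)

subsection \<open>The chain measure\<close>

text \<open>The indices split into chains i, 2i, 4i, ... with i odd, and \<open>k div 2\<close> is
  the predecessor of an even \<open>k\<close>. Along each chain the bits form a Markov chain; a
  chain starts as if its predecessor were 0.\<close>

definition one_before :: "(nat \<Rightarrow> nat) \<Rightarrow> nat \<Rightarrow> bool" where
  "one_before \<omega> k \<longleftrightarrow> even k \<and> \<omega> (k div 2) = 1"

definition chain_prob :: "real \<Rightarrow> real \<Rightarrow> (nat \<Rightarrow> nat) \<Rightarrow> nat \<Rightarrow> real" where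
  "chain_prob p q \<omega> k = (if one_before \<omega> k then q else p)"

definition chain_weight :: "real \<Rightarrow> real \<Rightarrow> nat \<Rightarrow> (nat \<Rightarrow> nat) \<Rightarrow> real" where
  "chain_weight p q n \<omega> =
     (\<Prod>k=1..n. if \<omega> k = 1 then chain_prob p q \<omega> k else 1 - chain_prob p q \<omega> k)"

lemma cylinder_cong:
  assumes "\<tau> \<in> cylinder n \<omega>" "k \<in> {1..n}"
  shows "\<tau> k = \<omega> k" "one_before \<tau> k = one_before \<omega> k"
proof -
  show "\<tau> k = \<omega> k" using assms by (simp add: cylinder_def)
  have "\<tau> (k div 2) = \<omega> (k div 2)" if "even k"
  proof -
    have "k div 2 \<in> {1..n}" using that assms(2) by (auto elim!: evenE)
    then show ?thesis using assms(1) by (simp add: cylinder_def)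
  qed
  then show "one_before \<tau> k = one_before \<omega> k" by (auto simp: one_before_def)
qed

lemma chain_weight_cylinder:
  assumes "\<tau> \<in> cylinder n \<omega>"
  shows "chain_weight p q n \<tau> = chain_weight p q n \<omega>"
  unfolding chain_weight_def
  by (rule prod.cong) (use cylinder_cong[OF assms] in \<open>auto simp: chain_prob_def\<close>)

lemma chain_weight_nonneg:
  assumes "p \<in> {0..1}" "q \<in> {0..1}"
  shows "0 \<le> chain_weight p q n \<omega>"
  unfolding chain_weight_def by (rule prod_nonneg) (use assms in \<open>auto simp: chain_prob_def\<close>)

text \<open>Only the masses of cylinders are prescribed, and the parameters are part of the locale,
  so a second measure with tilted parameters can be interpreted beside the first.\<close>

locale chain_measure = prob_space M for M :: "(nat \<Rightarrow> nat) measure" +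
  fixes p q :: real
  assumes p01: "p \<in> {0..1}" and q01: "q \<in> {0..1}"
    and space_eq: "space M = seq_space"
    and cylinder_sets: "\<And>n \<tau>. \<tau> \<in> seq_space \<Longrightarrow> cylinder n \<tau> \<in> sets M"
    and cylinder_measure: "\<And>n \<tau>. \<tau> \<in> seq_space \<Longrightarrow> prob (cylinder n \<tau>) = chain_weight p q n \<tau>"

text \<open>A sequence is sampled from independent bits \<open>x (k, c)\<close>, where \<open>c\<close> tells which of the two
  transition probabilities (\<open>q\<close> for \<open>True\<close>, \<open>p\<close> for \<open>False\<close>) applies at \<open>k\<close>; only one of
  the two bits at \<open>k\<close> is read.\<close>

fun chain_bit :: "(nat \<times> bool \<Rightarrow> bool) \<Rightarrow> nat \<Rightarrow> bool" where
  "chain_bit x k = (if k = 0 then False else x (k, even k \<and> chain_bit x (k div 2)))"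

declare chain_bit.simps [simp del]

definition chain_seq :: "(nat \<times> bool \<Rightarrow> bool) \<Rightarrow> nat \<Rightarrow> nat" where
  "chain_seq x = (\<lambda>k\<in>{1..}. of_bool (chain_bit x k))"

lemma chain_seq_in_space: "chain_seq x \<in> seq_space"
  unfolding chain_seq_def seq_space_def by (auto simp: PiE_iff)

lemma chain_seq_step:
  assumes "1 \<le> k"
  shows "chain_seq x k = of_bool (x (k, one_before (chain_seq x) k))"
proof -
  have "one_before (chain_seq x) k \<longleftrightarrow> even k \<and> chain_bit x (k div 2)"
    using assms by (auto simp: one_before_def chain_seq_def elim!: evenE)
  then show ?thesis using assms chain_bit.simps[of x k] by (simp add: chain_seq_def)
qed

text \<open>Being in a cylinder prescribes exactly one of the independent bits for each index up to
  \<open>n\<close>, and which one is read is determined by \<open>\<tau>\<close>. This gives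
  cylinder probabilities their product form.\<close>

lemma chain_seq_in_cylinder_iff:
  assumes "\<tau> \<in> seq_space"
  shows "chain_seq x \<in> cylinder n \<tau> \<longleftrightarrow> (\<forall>k\<in>{1..n}. x (k, one_before \<tau> k) = (\<tau> k = 1))"
proof
  assume *: "chain_seq x \<in> cylinder n \<tau>"
  show "\<forall>k\<in>{1..n}. x (k, one_before \<tau> k) = (\<tau> k = 1)"
  proof
    fix k assume k: "k \<in> {1..n}"
    show "x (k, one_before \<tau> k) = (\<tau> k = 1)"
      using chain_seq_step[of k x] cylinder_cong[OF * k] k by auto
  qed
next
  assume *: "\<forall>k\<in>{1..n}. x (k, one_before \<tau> k) = (\<tau> k = 1)"
  \<comment> \<open>Strong induction, because the bit read at \<open>k\<close> is selected by the
    coordinate \<open>k div 2\<close>.\<close>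
  have "k \<in> {1..n} \<Longrightarrow> chain_seq x k = \<tau> k" for k
  proof (induction k rule: less_induct)
    case (less k)
    have "chain_seq x (k div 2) = \<tau> (k div 2)" if "even k"
      using that less.prems by (intro less.IH) (auto elim!: evenE)
    then have "one_before (chain_seq x) k = one_before \<tau> k" by (auto simp: one_before_def)
    then show ?case
      using chain_seq_step[of k x] * less.prems seq_space_values[OF assms, of k] by auto
  qed
  then show "chain_seq x \<in> cylinder n \<tau>"
    using chain_seq_in_space by (auto simp: cylinder_def)
qed

text \<open>The measure is the image under \<open>chain_seq\<close> of a product of Bernoulli laws,
  on the sigma-algebra generated by the cylinders.\<close>

lemma chain_measure_exists:
  assumes "p \<in> {0..1}" "q \<in> {0..1}"
  shows "\<exists>M. chain_measure M p q"
proof -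
  define B where "B = (\<lambda>(k::nat, c::bool). measure_pmf (bernoulli_pmf (if c then q else p)))"
  have "prob_space (B i)" for i
    unfolding B_def by (auto split: prod.split intro: measure_pmf.prob_space_axioms)
  then interpret product_prob_space B "UNIV :: (nat \<times> bool) set"
    by (auto simp: product_prob_space_def product_prob_space_axioms_def product_sigma_finite_def
        prob_space_imp_sigma_finite)
  let ?\<Omega> = "PiM UNIV B"
  have setsB: "sets (B i) = UNIV" "space (B i) = UNIV" for i by (auto simp: B_def split: prod.split)
  have spaceP: "space ?\<Omega> = UNIV" by (simp add: space_PiM setsB)
  define \<C> where "\<C> = {cylinder n \<tau> | n \<tau>. \<tau> \<in> seq_space}"
  have \<C>: "\<C> \<subseteq> Pow seq_space" by (auto simp: \<C>_def cylinder_def)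
  define N where "N = sigma seq_space \<C>"
  have vim: "chain_seq -` cylinder n \<tau> =
      {x \<in> space ?\<Omega>. \<forall>i\<in>(\<lambda>k. (k, one_before \<tau> k)) ` {1..n}. x i \<in> {\<tau> (fst i) = 1}}"
    if "\<tau> \<in> seq_space" for n \<tau>
    by (simp add: chain_seq_in_cylinder_iff[OF that] spaceP vimage_def)
  have vim_sets: "chain_seq -` cylinder n \<tau> \<in> sets ?\<Omega>" if "\<tau> \<in> seq_space" for n \<tau>
    unfolding vim[OF that] by (intro sets.sets_Collect_finite_All sets_Collect_single) (auto simp: setsB)
  have meas: "chain_seq \<in> measurable ?\<Omega> N"
    unfolding N_def
    by (rule measurable_measure_of[OF \<C>])
      (use chain_seq_in_space vim_sets in \<open>auto simp: \<C>_def spaceP\<close>)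
  interpret D: prob_space "distr ?\<Omega> N chain_seq" by (rule P.prob_space_distr[OF meas])
  have "chain_measure (distr ?\<Omega> N chain_seq) p q"
  proof unfold_locales
    show "space (distr ?\<Omega> N chain_seq) = seq_space" by (simp add: N_def space_measure_of[OF \<C>])
    fix n \<tau> assume \<tau>: "\<tau> \<in> seq_space"
    have cN: "cylinder n \<tau> \<in> sets N"
      unfolding N_def using \<C> \<tau> by (auto simp: \<C>_def sets_measure_of)
    then show "cylinder n \<tau> \<in> sets (distr ?\<Omega> N chain_seq)" by simp
    \<comment> \<open>Different indices read different bits, so the product over bits can be
      rewritten as a product over indices.\<close>
    have inj: "inj_on (\<lambda>k. (k, one_before \<tau> k)) {1..n}" by (auto simp: inj_on_def)
    have "measure (distr ?\<Omega> N chain_seq) (cylinder n \<tau>) = measure ?\<Omega> (chain_seq -` cylinder n \<tau>)"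
      using measure_distr[OF meas cN] by (simp add: spaceP)
    also have "\<dots> = (\<Prod>i\<in>(\<lambda>k. (k, one_before \<tau> k)) ` {1..n}. measure (B i) {\<tau> (fst i) = 1})"
      using emeasure_PiM_Collect[of "(\<lambda>k. (k, one_before \<tau> k)) ` {1..n}" "\<lambda>i. {\<tau> (fst i) = 1}"]
      unfolding vim[OF \<tau>] P.emeasure_eq_measure M.emeasure_eq_measure
      by (simp add: setsB prod_ennreal prod_nonneg)
    also have "\<dots> = (\<Prod>k=1..n. measure (B (k, one_before \<tau> k)) {\<tau> k = 1})"
      by (subst prod.reindex[OF inj]) simp
    also have "\<dots> = chain_weight p q n \<tau>"
      unfolding chain_weight_def
      by (rule prod.cong)
        (use assms in \<open>auto simp: B_def chain_prob_def measure_pmf_single\<close>)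
    finally show "measure (distr ?\<Omega> N chain_seq) (cylinder n \<tau>) = chain_weight p q n \<tau>" .
  qed (use assms in auto)
  then show ?thesis by blast
qed

subsection \<open>Cylinder weights and deviations\<close>

definition ones_count :: "nat \<Rightarrow> (nat \<Rightarrow> nat) \<Rightarrow> real" where
  "ones_count n \<omega> = (\<Sum>k=1..n. real (\<omega> k))"

definition pairs_count :: "nat \<Rightarrow> (nat \<Rightarrow> nat) \<Rightarrow> real" where
  "pairs_count n \<omega> = (\<Sum>k=1..n. real (\<omega> k * \<omega> (2 * k)))"

text \<open>Only an even index 2j contributes, namely \<open>\<omega> j\<close> with j at most
  \<open>n div 2\<close>. This halving is the source of the terms \<open>\<theta> / 2\<close> and
  \<open>\<alpha> / 2\<close> in the entropy rate.\<close>

lemma sum_one_before: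
  assumes "\<omega> \<in> seq_space"
  shows "(\<Sum>k=1..n. of_bool (one_before \<omega> k)) = ones_count (n div 2) \<omega>"
proof (induction n)
  case (Suc n)
  show ?case
  proof (cases "even (Suc n)")
    case True
    then have *: "Suc n div 2 = Suc (n div 2)" by (auto elim!: oddE)
    show ?thesis using Suc True seq_space_values[OF assms, of "Suc (n div 2)"]
      by (auto simp: ones_count_def * one_before_def)
  next
    case False
    then have "Suc n div 2 = n div 2" by (auto elim!: evenE)
    then show ?thesis using Suc False by (simp add: one_before_def)
  qed
qed (simp add: ones_count_def)

lemma sum_one_before_mult:
  assumes "\<omega> \<in> seq_space"
  shows "(\<Sum>k=1..n. of_bool (one_before \<omega> k) * real (\<omega> k)) = pairs_count (n div 2) \<omega>"
proof (induction n)
  case (Suc n)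
  show ?case
  proof (cases "even (Suc n)")
    case True
    then have *: "Suc n div 2 = Suc (n div 2)" "2 * Suc (n div 2) = Suc n" by (auto elim!: oddE)
    show ?thesis using Suc True seq_space_values[OF assms, of "Suc (n div 2)"] *(2)
      by (auto simp: pairs_count_def *(1) one_before_def)
  next
    case False
    then have "Suc n div 2 = n div 2" by (auto elim!: evenE)
    then show ?thesis using Suc False by (simp add: one_before_def)
  qed
qed (simp add: pairs_count_def)

text \<open>Every factor is one of q, 1 - q, p, 1 - p, selected by products of the indicators of
  \<open>one_before\<close> and of a one at \<open>k\<close>. Positivity excludes zero factors, for
  which \<open>ln 0 = 0\<close> would break additivity.\<close>

lemma ln_chain_weight:
  assumes \<omega>: "\<omega> \<in> seq_space" and pos: "0 < chain_weight p q n \<omega>"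
  shows "ln (chain_weight p q n \<omega>) =
      pairs_count (n div 2) \<omega> * ln q + (ones_count (n div 2) \<omega> - pairs_count (n div 2) \<omega>) * ln (1 - q)
    + (ones_count n \<omega> - pairs_count (n div 2) \<omega>) * ln p
    + (real n - ones_count (n div 2) \<omega> - ones_count n \<omega> + pairs_count (n div 2) \<omega>) * ln (1 - p)"
proof -
  let ?f = "\<lambda>k. if \<omega> k = 1 then chain_prob p q \<omega> k else 1 - chain_prob p q \<omega> k"
  let ?c = "\<lambda>k. of_bool (one_before \<omega> k) :: real"
  have "(\<Prod>k=1..n. ?f k) \<noteq> 0" using pos unfolding chain_weight_def by (rule less_imp_neq[symmetric])
  then have nz: "\<forall>k\<in>{1..n}. ?f k \<noteq> 0" by (subst (asm) prod_zero_iff) auto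
  then have "ln (chain_weight p q n \<omega>) = (\<Sum>k=1..n. ln (?f k))"
    unfolding chain_weight_def by (intro ln_prod) (use nz in blast)+
  also have "\<dots> = (\<Sum>k=1..n. ?c k * real (\<omega> k) * ln q + (?c k - ?c k * real (\<omega> k)) * ln (1 - q)
      + (real (\<omega> k) - ?c k * real (\<omega> k)) * ln p
      + (1 - ?c k - real (\<omega> k) + ?c k * real (\<omega> k)) * ln (1 - p))"
  proof (rule sum.cong[OF refl])
    fix k assume "k \<in> {1..n}"
    then have "\<omega> k = 0 \<or> \<omega> k = 1" using seq_space_values[OF \<omega>] by simp
    then show "ln (?f k) = ?c k * real (\<omega> k) * ln q + (?c k - ?c k * real (\<omega> k)) * ln (1 - q)
      + (real (\<omega> k) - ?c k * real (\<omega> k)) * ln p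
      + (1 - ?c k - real (\<omega> k) + ?c k * real (\<omega> k)) * ln (1 - p)"
      by (auto simp: chain_prob_def)
  qed
  also have "\<dots> = (\<Sum>k=1..n. ?c k * real (\<omega> k)) * ln q
      + ((\<Sum>k=1..n. ?c k) - (\<Sum>k=1..n. ?c k * real (\<omega> k))) * ln (1 - q)
      + ((\<Sum>k=1..n. real (\<omega> k)) - (\<Sum>k=1..n. ?c k * real (\<omega> k))) * ln p
      + (real n - (\<Sum>k=1..n. ?c k) - (\<Sum>k=1..n. real (\<omega> k)) + (\<Sum>k=1..n. ?c k * real (\<omega> k))) * ln (1 - p)"
    by (simp only: sum.distrib sum_subtractf sum_distrib_right[symmetric]) simp
  finally show ?thesis
    unfolding sum_one_before[OF \<omega>] sum_one_before_mult[OF \<omega>] ones_count_def[of n, symmetric] .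
qed

text \<open>Under the chain measure with parameters \<open>p\<close>, \<open>q\<close> this is a
  martingale: each bit is centred by its conditional mean given the earlier bits. The weights
  \<open>u\<close> and \<open>v\<close> separate the indices after a one from the others.\<close>

definition chain_dev :: "real \<Rightarrow> real \<Rightarrow> real \<Rightarrow> real \<Rightarrow> nat \<Rightarrow> (nat \<Rightarrow> nat) \<Rightarrow> real" where
  "chain_dev p q u v n \<omega> =
     (\<Sum>k=1..n. (if one_before \<omega> k then u else v) * (real (\<omega> k) - chain_prob p q \<omega> k))"

lemma chain_dev_eq:
  assumes \<omega>: "\<omega> \<in> seq_space"
  shows "chain_dev p q u v n \<omega> =
      u * (pairs_count (n div 2) \<omega> - q * ones_count (n div 2) \<omega>)
    + v * (ones_count n \<omega> - pairs_count (n div 2) \<omega> - p * (real n - ones_count (n div 2) \<omega>))"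
proof -
  let ?c = "\<lambda>k. of_bool (one_before \<omega> k) :: real"
  have "chain_dev p q u v n \<omega> = (\<Sum>k=1..n. u * (?c k * real (\<omega> k) - q * ?c k)
      + v * (real (\<omega> k) - ?c k * real (\<omega> k) - p * (1 - ?c k)))"
    unfolding chain_dev_def by (rule sum.cong) (auto simp: chain_prob_def)
  also have "\<dots> = u * ((\<Sum>k=1..n. ?c k * real (\<omega> k)) - q * (\<Sum>k=1..n. ?c k))
      + v * ((\<Sum>k=1..n. real (\<omega> k)) - (\<Sum>k=1..n. ?c k * real (\<omega> k)) - p * (real n - (\<Sum>k=1..n. ?c k)))"
    by (simp only: sum.distrib sum_subtractf sum_distrib_left[symmetric]) simp
  finally show ?thesis
    unfolding sum_one_before[OF \<omega>] sum_one_before_mult[OF \<omega>] ones_count_def[of n, symmetric] .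
qed

text \<open>A consequence of ln (1 + y) >= y - 2 y^2 for |y| at most 1/2. It compares the tilted
  factors with an exponential of the deviation.\<close>

lemma exp_le_one_plus:
  fixes x t :: real
  assumes "\<bar>x\<bar> \<le> 1" "0 \<le> t" "t \<le> 1 / 2"
  shows "exp (t * x - 2 * t\<^sup>2) \<le> 1 + t * x"
proof -
  have tx: "\<bar>t * x\<bar> \<le> t" using assms mult_left_mono[of "\<bar>x\<bar>" 1 t] by (simp add: abs_mult)
  then have "\<bar>ln (1 + t * x) - t * x\<bar> \<le> 2 * (t * x)\<^sup>2"
    using assms by (intro abs_ln_one_plus_x_minus_x_bound) auto
  moreover have "(t * x)\<^sup>2 \<le> t\<^sup>2" using abs_le_square_iff[of "t * x" t] tx assms by simp
  ultimately have "t * x - 2 * t\<^sup>2 \<le> ln (1 + t * x)" by linarith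
  moreover have "0 < 1 + t * x" using tx assms by linarith
  ultimately show ?thesis by (metis exp_le_cancel_iff exp_ln)
qed

text \<open>Tilting the transition probabilities multiplies each factor of the weight by
  \<open>1 + t d\<close>, where \<open>d\<close> is the corresponding summand of the deviation.\<close>

lemma chain_weight_tilt:
  assumes p: "p \<in> {0..1}" and q: "q \<in> {0..1}" and \<omega>: "\<omega> \<in> seq_space"
    and uv: "\<bar>u\<bar> \<le> 1" "\<bar>v\<bar> \<le> 1" and t: "0 \<le> t" "t \<le> 1 / 2"
  shows "chain_weight p q n \<omega> * exp (t * chain_dev p q u v n \<omega> - 2 * t\<^sup>2 * real n)
     \<le> chain_weight (p + t * v * p * (1 - p)) (q + t * u * q * (1 - q)) n \<omega>"
proof -
  let ?w = "\<lambda>p q k. if \<omega> k = 1 then chain_prob p q \<omega> k else 1 - chain_prob p q \<omega> k"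
  let ?d = "\<lambda>k. (if one_before \<omega> k then u else v) * (real (\<omega> k) - chain_prob p q \<omega> k)"
  let ?p = "p + t * v * p * (1 - p)" and ?q = "q + t * u * q * (1 - q)"
  have "chain_weight p q n \<omega> * exp (t * chain_dev p q u v n \<omega> - 2 * t\<^sup>2 * real n)
      = (\<Prod>k=1..n. ?w p q k) * exp (\<Sum>k=1..n. t * ?d k - 2 * t\<^sup>2)"
    unfolding chain_weight_def chain_dev_def
    by (simp add: sum_subtractf sum_distrib_left mult.assoc)
  also have "\<dots> = (\<Prod>k=1..n. ?w p q k * exp (t * ?d k - 2 * t\<^sup>2))"
    by (simp add: exp_sum prod.distrib)
  also have "\<dots> \<le> (\<Prod>k=1..n. ?w ?p ?q k)"
  proof (rule prod_mono, intro conjI)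
    fix k assume k: "k \<in> {1..n}"
    then have val: "\<omega> k = 0 \<or> \<omega> k = 1" using seq_space_values[OF \<omega>] by simp
    have w0: "0 \<le> ?w p q k" using p q by (auto simp: chain_prob_def)
    then show "0 \<le> ?w p q k * exp (t * ?d k - 2 * t\<^sup>2)" by simp
    have d1: "\<bar>real (\<omega> k) - chain_prob p q \<omega> k\<bar> \<le> 1"
      using val p q by (auto simp: chain_prob_def)
    have "\<bar>?d k\<bar> \<le> 1 * 1"
      unfolding abs_mult by (rule mult_mono) (use d1 uv in auto)
    then have "?w p q k * exp (t * ?d k - 2 * t\<^sup>2) \<le> ?w p q k * (1 + t * ?d k)"
      using w0 t by (intro mult_left_mono exp_le_one_plus) auto
    \<comment> \<open>With parameter p, a one gives p (1 + t v (1 - p)) and a zero gives (1 - p) (1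
      - t v p). These are p' and 1 - p' for p' = p + t v p (1 - p), which explains the form of the
      tilt.\<close>
    also have "\<dots> = ?w ?p ?q k"
      using val by (auto simp: chain_prob_def algebra_simps)
    finally show "?w p q k * exp (t * ?d k - 2 * t\<^sup>2) \<le> ?w ?p ?q k" .
  qed
  finally show ?thesis by (simp add: chain_weight_def)
qed

text \<open>The shift is at most p (1 - p) in absolute value, hence at most the distance from p to
  either end of the interval.\<close>

lemma tilt_in_unit:
  fixes p t v :: real
  assumes "p \<in> {0..1}" "\<bar>v\<bar> \<le> 1" "0 \<le> t" "t \<le> 1 / 2"
  shows "p + t * v * p * (1 - p) \<in> {0..1}"
proof -
  have "\<bar>t * v\<bar> \<le> 1 / 2 * 1" unfolding abs_mult by (rule mult_mono) (use assms in auto)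
  then have tv: "\<bar>t * v\<bar> \<le> 1" by simp
  have "\<bar>t * v * (p * (1 - p))\<bar> \<le> 1 * (p * (1 - p))"
    unfolding abs_mult[of "t * v"] using tv assms by (intro mult_mono) (auto simp: abs_mult)
  moreover have "p * (1 - p) \<le> p" "p * (1 - p) \<le> 1 - p"
    using assms mult_left_le[of "1 - p" p] mult_right_le_one_le[of "1 - p" p] by (auto simp: mult.commute)
  ultimately show ?thesis by (auto simp: mult.assoc)
qed

lemma chain_dev_cylinder:
  assumes "\<tau> \<in> cylinder n \<omega>"
  shows "chain_dev p q u v n \<tau> = chain_dev p q u v n \<omega>"
  unfolding chain_dev_def
  by (rule sum.cong) (use cylinder_cong[OF assms] in \<open>auto simp: chain_prob_def\<close>)

section \<open>Exponential deviation bounds and the law of large numbers\<close>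

context chain_measure
begin

lemma determined_measure:
  assumes "A \<subseteq> seq_space" and "\<And>\<omega>. \<omega> \<in> A \<Longrightarrow> cylinder n \<omega> \<subseteq> A"
  shows "A \<in> events" and "prob A = (\<Sum>w\<in>seq_words n \<inter> A. chain_weight p q n w)"
proof -
  have sub: "seq_words n \<inter> A \<subseteq> seq_space" using assms by blast
  have fin: "finite (seq_words n \<inter> A)" using finite_seq_words by blast
  have sets: "cylinder n ` (seq_words n \<inter> A) \<subseteq> events" using cylinder_sets sub by blast
  note eq = determined_eq_Union_cylinders[OF assms]
  have "(\<Union>w\<in>seq_words n \<inter> A. cylinder n w) \<in> events" using sets fin by (intro sets.finite_UN) auto
  then show "A \<in> events" by (simp only: eq[symmetric])
  have "prob (\<Union>w\<in>seq_words n \<inter> A. cylinder n w) = (\<Sum>w\<in>seq_words n \<inter> A. prob (cylinder n w))"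
    by (rule finite_measure_finite_Union[OF fin sets])
      (use disjoint_cylinders in \<open>auto simp: disjoint_family_on_def\<close>)
  then have "prob A = (\<Sum>w\<in>seq_words n \<inter> A. prob (cylinder n w))"
    by (simp only: eq[symmetric])
  also have "\<dots> = (\<Sum>w\<in>seq_words n \<inter> A. chain_weight p q n w)"
    using sub by (intro sum.cong) (auto simp: cylinder_measure)
  finally show "prob A = (\<Sum>w\<in>seq_words n \<inter> A. chain_weight p q n w)" .
qed

lemma sum_chain_weight_le_1:
  assumes "W \<subseteq> seq_words n"
  shows "(\<Sum>w\<in>W. chain_weight p q n w) \<le> 1"
proof -
  have "(\<Sum>w\<in>W. chain_weight p q n w) \<le> (\<Sum>w\<in>seq_words n \<inter> seq_space. chain_weight p q n w)"
    using assms seq_words_subset finite_seq_words chain_weight_nonneg[OF p01 q01]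
    by (intro sum_mono2) auto
  also have "\<dots> = prob seq_space"
    by (rule determined_measure(2)[symmetric]) (auto simp: cylinder_def)
  finally show ?thesis using prob_le_1 by (rule order_trans)
qed

text \<open>A Chernoff bound by change of measure: on the event the tilted weight is at least exp (n
  \<epsilon>^2 / 8) times the original one, while the tilted weights of words of length
  \<open>n\<close> sum to at most 1.\<close>

lemma prob_chain_dev_ge:
  assumes uv: "\<bar>u\<bar> \<le> 1" "\<bar>v\<bar> \<le> 1" and \<epsilon>: "0 < \<epsilon>" "\<epsilon> \<le> 1"
  shows "{\<omega> \<in> seq_space. \<epsilon> * real n \<le> chain_dev p q u v n \<omega>} \<in> events"
    and "prob {\<omega> \<in> seq_space. \<epsilon> * real n \<le> chain_dev p q u v n \<omega>} \<le> exp (- (\<epsilon>\<^sup>2 / 8)) ^ n"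
proof -
  let ?A = "{\<omega> \<in> seq_space. \<epsilon> * real n \<le> chain_dev p q u v n \<omega>}"
  have A: "?A \<subseteq> seq_space" "\<And>\<omega>. \<omega> \<in> ?A \<Longrightarrow> cylinder n \<omega> \<subseteq> ?A"
    using chain_dev_cylinder[of _ n] by (auto dest: cylinder_subset[THEN subsetD])
  show "?A \<in> events" by (rule determined_measure(1)[OF A])
  \<comment> \<open>This value maximises t \<epsilon> - 2 t^2; the maximum is \<epsilon>^2 /
    8.\<close>
  define t where "t = \<epsilon> / 4"
  have t: "0 \<le> t" "t \<le> 1 / 2" using \<epsilon> by (auto simp: t_def)
  define p' where "p' = p + t * v * p * (1 - p)"
  define q' where "q' = q + t * u * q * (1 - q)"
  have p'q': "p' \<in> {0..1}" "q' \<in> {0..1}"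
    unfolding p'_def q'_def using p01 q01 uv t by (intro tilt_in_unit; simp)+
  obtain M' where "chain_measure M' p' q'" using chain_measure_exists[OF p'q'] by blast
  then interpret M': chain_measure M' p' q' .
  have "prob ?A = (\<Sum>w\<in>seq_words n \<inter> ?A. chain_weight p q n w)"
    by (rule determined_measure(2)[OF A])
  also have "\<dots> \<le> (\<Sum>w\<in>seq_words n \<inter> ?A. exp (- (\<epsilon>\<^sup>2 / 8)) ^ n * chain_weight p' q' n w)"
  proof (rule sum_mono)
    fix w assume w: "w \<in> seq_words n \<inter> ?A"
    have "t * (\<epsilon> * real n) \<le> t * chain_dev p q u v n w"
      using w t by (intro mult_left_mono) auto
    then have le: "real n * (\<epsilon>\<^sup>2 / 8) \<le> t * chain_dev p q u v n w - 2 * t\<^sup>2 * real n"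
      by (simp add: t_def power2_eq_square)
    have "chain_weight p q n w = exp (- (\<epsilon>\<^sup>2 / 8)) ^ n * (chain_weight p q n w * exp (real n * (\<epsilon>\<^sup>2 / 8)))"
      by (simp add: exp_of_nat_mult[symmetric] exp_minus field_simps)
    also have "\<dots> \<le> exp (- (\<epsilon>\<^sup>2 / 8)) ^ n *
        (chain_weight p q n w * exp (t * chain_dev p q u v n w - 2 * t\<^sup>2 * real n))"
      using le chain_weight_nonneg[OF p01 q01] by (intro mult_left_mono) auto
    also have "\<dots> \<le> exp (- (\<epsilon>\<^sup>2 / 8)) ^ n * chain_weight p' q' n w"
      unfolding p'_def q'_def
      by (intro mult_left_mono chain_weight_tilt p01 q01 uv t) (use w in auto)
    finally show "chain_weight p q n w \<le> exp (- (\<epsilon>\<^sup>2 / 8)) ^ n * chain_weight p' q' n w" .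
  qed
  also have "\<dots> = exp (- (\<epsilon>\<^sup>2 / 8)) ^ n * (\<Sum>w\<in>seq_words n \<inter> ?A. chain_weight p' q' n w)"
    by (rule sum_distrib_left[symmetric])
  also have "\<dots> \<le> exp (- (\<epsilon>\<^sup>2 / 8)) ^ n * 1"
    by (intro mult_left_mono M'.sum_chain_weight_le_1) auto
  finally show "prob ?A \<le> exp (- (\<epsilon>\<^sup>2 / 8)) ^ n" by simp
qed

text \<open>The deviation bounds are geometric in \<open>n\<close>, hence summable, and
  Borel-Cantelli applies. Testing the tolerances 1 / (j + 1) keeps the exceptional set a countable
  union of null sets.\<close>

lemma AE_chain_dev_less:
  assumes uv: "\<bar>u\<bar> \<le> 1" "\<bar>v\<bar> \<le> 1"
  shows "AE \<omega> in M. \<forall>\<epsilon>>0. \<forall>\<^sub>F n in sequentially. chain_dev p q u v n \<omega> < \<epsilon> * real n"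
proof -
  have "AE \<omega> in M. \<forall>\<^sub>F n in sequentially. chain_dev p q u v n \<omega> < 1 / Suc j * real n" for j
  proof -
    have j: "0 < 1 / real (Suc j)" "1 / real (Suc j) \<le> 1" by auto
    note P = prob_chain_dev_ge[OF uv j]
    have "AE \<omega> in M. \<forall>\<^sub>F n in sequentially.
        \<omega> \<in> space M - {\<omega> \<in> seq_space. 1 / real (Suc j) * real n \<le> chain_dev p q u v n \<omega>}"
    proof (rule borel_cantelli_AE1)
      show "summable (\<lambda>n. prob {\<omega> \<in> seq_space. 1 / real (Suc j) * real n \<le> chain_dev p q u v n \<omega>})"
        by (rule summable_comparison_test'[OF summable_geometric[of "exp (- ((1 / real (Suc j))\<^sup>2 / 8))"], of 0])
          (use P(2) in auto)
    qed (use P(1) in \<open>auto simp: less_top[symmetric]\<close>)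
    then show ?thesis
      by (rule AE_mp) (auto simp: space_eq elim!: eventually_mono intro!: AE_I2)
  qed
  then have "AE \<omega> in M. \<forall>j. \<forall>\<^sub>F n in sequentially. chain_dev p q u v n \<omega> < 1 / Suc j * real n"
    by (simp add: AE_all_countable)
  then show ?thesis
  proof (rule AE_mp, intro AE_I2 impI allI)
    fix \<omega> and \<epsilon> :: real
    assume *: "\<forall>j. \<forall>\<^sub>F n in sequentially. chain_dev p q u v n \<omega> < 1 / Suc j * real n" and "0 < \<epsilon>"
    then obtain j where "1 / real (Suc j) < \<epsilon>" using nat_approx_posE by blast
    then have "1 / Suc j * real n \<le> \<epsilon> * real n" for n by (intro mult_right_mono) auto
    then show "\<forall>\<^sub>F n in sequentially. chain_dev p q u v n \<omega> < \<epsilon> * real n"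
      using *[rule_format, of j] by (auto elim!: eventually_mono intro: less_le_trans)
  qed
qed

lemma AE_chain_dev_tendsto:
  assumes uv: "\<bar>u\<bar> \<le> 1" "\<bar>v\<bar> \<le> 1"
  shows "AE \<omega> in M. (\<lambda>n. chain_dev p q u v n \<omega> / real n) \<longlonglongrightarrow> 0"
proof -
  have neg: "chain_dev p q (- u) (- v) n \<omega> = - chain_dev p q u v n \<omega>" for n \<omega>
    unfolding chain_dev_def sum_negf[symmetric] by (rule sum.cong) auto
  have "AE \<omega> in M. \<forall>\<epsilon>>0. \<forall>\<^sub>F n in sequentially. chain_dev p q u v n \<omega> < \<epsilon> * real n"
    by (rule AE_chain_dev_less[OF uv])
  moreover have "AE \<omega> in M. \<forall>\<epsilon>>0. \<forall>\<^sub>F n in sequentially. - chain_dev p q u v n \<omega> < \<epsilon> * real n"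
    using AE_chain_dev_less[of "- u" "- v"] uv by (simp add: neg)
  ultimately show ?thesis
  proof eventually_elim
    case (elim \<omega>)
    show ?case
    proof (rule tendstoI)
      fix \<epsilon> :: real assume "0 < \<epsilon>"
      with elim have "\<forall>\<^sub>F n in sequentially. chain_dev p q u v n \<omega> < \<epsilon> * real n"
        "\<forall>\<^sub>F n in sequentially. - chain_dev p q u v n \<omega> < \<epsilon> * real n" by auto
      then show "\<forall>\<^sub>F n in sequentially. dist (chain_dev p q u v n \<omega> / real n) 0 < \<epsilon>"
        using eventually_gt_at_top[of 0]
        by eventually_elim (auto simp: abs_if field_simps)
    qed
  qed
qed

text \<open>For each \<open>n\<close>, finitely many cylinders of mass zero are discarded. This
  matters when an optimal parameter is 0 or 1, and for \<open>q = 0\<close> it forces the golden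
  condition.\<close>

lemma AE_chain_weight_pos: "AE \<omega> in M. \<forall>n. 0 < chain_weight p q n \<omega>"
proof -
  have "AE \<omega> in M. 0 < chain_weight p q n \<omega>" for n
  proof -
    let ?A = "{\<omega> \<in> seq_space. chain_weight p q n \<omega> = 0}"
    have A: "?A \<subseteq> seq_space" "\<And>\<omega>. \<omega> \<in> ?A \<Longrightarrow> cylinder n \<omega> \<subseteq> ?A"
      using chain_weight_cylinder[of _ n] by (auto dest: cylinder_subset[THEN subsetD])
    have "prob ?A = 0" by (subst determined_measure(2)[OF A]) (auto intro: sum.neutral)
    then have "AE \<omega> in M. \<omega> \<notin> ?A"
      using prob_eq_0 determined_measure(1)[OF A] by blast
    then show ?thesis
      by (rule AE_mp)
        (use chain_weight_nonneg[OF p01 q01] in \<open>auto simp: space_eq less_le intro!: AE_I2\<close>)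
  qed
  then show ?thesis by (simp add: AE_all_countable)
qed

end

subsection \<open>Entropy bounds from local masses\<close>

text \<open>Transports a countable family indexed by pairs (length, centre) to the index sets of
  naturals used in the definition of the premeasure.\<close>

lemma entropy_premeasure_le_infsum:
  assumes J: "countable J" "J \<subseteq> {N..} \<times> seq_space"
    and E: "E \<subseteq> (\<Union>(n, x)\<in>J. cylinder n x)"
  shows "entropy_premeasure s N E \<le> (\<Sum>\<^sub>\<infinity>(n, x)\<in>J. ennreal (exp (- s * real n)))"
proof -
  let ?g = "\<lambda>i. from_nat_into J i"
  have g: "?g (to_nat_on J j) = j" if "j \<in> J" for j using J(1) that by simp
  have "entropy_premeasure s N E
      \<le> (\<Sum>\<^sub>\<infinity>i\<in>to_nat_on J ` J. ennreal (exp (- s * real (fst (?g i)))))"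
    unfolding entropy_premeasure_def
  proof (intro Inf_lower CollectI exI conjI)
    show "\<forall>i\<in>to_nat_on J ` J. N \<le> fst (?g i) \<and> snd (?g i) \<in> seq_space"
      using J g by auto
    show "E \<subseteq> (\<Union>i\<in>to_nat_on J ` J. cylinder (fst (?g i)) (snd (?g i)))"
    proof
      fix \<omega> assume "\<omega> \<in> E"
      then obtain j where j: "j \<in> J" "\<omega> \<in> cylinder (fst j) (snd j)" using E by fastforce
      then show "\<omega> \<in> (\<Union>i\<in>to_nat_on J ` J. cylinder (fst (?g i)) (snd (?g i)))"
        by (intro UN_I[of "to_nat_on J j"]) (simp_all add: g)
    qed
  qed simp
  also have "\<dots> = (\<Sum>\<^sub>\<infinity>(n, x)\<in>J. ennreal (exp (- s * real n)))"
    by (subst infsum_reindex[OF inj_on_to_nat_on[OF J(1)]])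
      (auto intro!: infsum_cong simp: g)
  finally show ?thesis .
qed

section \<open>Upper bound by counting and lower bound by mass distribution\<close>

context chain_measure
begin

text \<open>Each such word carries mass at least exp (- s n), and the total mass is at most
  1.\<close>

lemma card_heavy_words:
  "real (card {w \<in> seq_words n. exp (- s * real n) \<le> chain_weight p q n w}) \<le> exp (s * real n)"
proof -
  let ?K = "{w \<in> seq_words n. exp (- s * real n) \<le> chain_weight p q n w}"
  have "real (card ?K) * exp (- s * real n) = (\<Sum>w\<in>?K. exp (- s * real n))" by simp
  also have "\<dots> \<le> (\<Sum>w\<in>?K. chain_weight p q n w)" by (rule sum_mono) auto
  also have "\<dots> \<le> 1" by (rule sum_chain_weight_le_1) auto
  finally show ?thesis by (simp add: exp_minus field_simps)
qed

text \<open>Each point of \<open>E\<close> has heavy prefixes of arbitrarily large length, so the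
  heavy words of all lengths from \<open>N\<close> on cover \<open>E\<close>. By the count of heavy
  words the cost of this cover is at most a geometric tail with ratio exp (s - t).\<close>

lemma entropy_measure_eq_0:
  assumes "E \<subseteq> seq_space" and "s < t"
    and heavy: "\<And>\<omega>. \<omega> \<in> E \<Longrightarrow> \<forall>\<^sub>F n in sequentially. exp (- s * real n) \<le> chain_weight p q n \<omega>"
  shows "entropy_measure t E = 0"
proof -
  define r where "r = exp (- (t - s))"
  have r: "0 < r" "r < 1" using assms(2) by (auto simp: r_def)
  define K where "K n = {w \<in> seq_words n. exp (- s * real n) \<le> chain_weight p q n w}" for n
  have finK: "finite (K n)" for n using finite_seq_words by (simp add: K_def)
  have le: "entropy_premeasure t N E \<le> ennreal (r ^ N / (1 - r))" for N
  proof -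
    define J where "J = (SIGMA n:{N..}. K n)"
    have "E \<subseteq> (\<Union>(n, x)\<in>J. cylinder n x)"
    proof
      fix \<omega> assume \<omega>: "\<omega> \<in> E"
      then obtain n where n: "N \<le> n" "exp (- s * real n) \<le> chain_weight p q n \<omega>"
        using eventually_conj[OF heavy[OF \<omega>] eventually_ge_at_top[of N]]
        by (auto simp: eventually_sequentially)
      have \<omega>': "\<omega> \<in> seq_space" using \<omega> assms(1) by blast
      then have "truncate_seq n \<omega> \<in> K n"
        using n chain_weight_cylinder[OF truncate_seq_in_cylinder[OF \<omega>']]
        by (simp add: K_def seq_words_def)
      then show "\<omega> \<in> (\<Union>(n, x)\<in>J. cylinder n x)"
        using in_cylinder_truncate_seq[OF \<omega>', of n] n(1) by (auto simp: J_def)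
    qed
    moreover have "countable J" unfolding J_def
      using finK by (intro countable_SIGMA) (auto intro: countable_finite)
    moreover have "J \<subseteq> {N..} \<times> seq_space"
      using seq_words_subset by (auto simp: J_def K_def)
    ultimately have "entropy_premeasure t N E \<le> (\<Sum>\<^sub>\<infinity>(n, x)\<in>J. ennreal (exp (- t * real n)))"
      by (intro entropy_premeasure_le_infsum)
    also have "\<dots> \<le> ennreal (r ^ N / (1 - r))"
    proof (subst nonneg_infsum_complete, simp, rule SUP_least)
      fix F assume "F \<in> {F. finite F \<and> F \<subseteq> J}"
      then have F: "finite F" "F \<subseteq> J" by auto
      define m where "m = Max (fst ` F)"
      have "F \<subseteq> (SIGMA n:{N..m}. K n)"
        using F by (auto simp: J_def m_def intro!: Max_ge imageI rev_image_eqI)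
      then have "(\<Sum>(n, x)\<in>F. exp (- t * real n)) \<le> (\<Sum>(n, x)\<in>(SIGMA n:{N..m}. K n). exp (- t * real n))"
        using finK by (intro sum_mono2 finite_SigmaI) auto
      also have "\<dots> = (\<Sum>n=N..m. real (card (K n)) * exp (- t * real n))"
        using finK by (subst sum.Sigma[symmetric]) auto
      also have "\<dots> \<le> (\<Sum>n=N..m. r ^ n)"
      proof (rule sum_mono)
        fix n
        have "real (card (K n)) * exp (- t * real n) \<le> exp (s * real n) * exp (- t * real n)"
          unfolding K_def by (intro mult_right_mono card_heavy_words) simp
        also have "\<dots> = r ^ n"
          by (simp add: r_def exp_of_nat_mult[symmetric] exp_add[symmetric] algebra_simps)
        finally show "real (card (K n)) * exp (- t * real n) \<le> r ^ n" .
      qed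
      also have "\<dots> \<le> r ^ N / (1 - r)"
        using r by (auto simp: sum_gp intro!: divide_right_mono)
      finally have "ennreal (\<Sum>(n, x)\<in>F. exp (- t * real n)) \<le> ennreal (r ^ N / (1 - r))"
        by (rule ennreal_leI)
      then show "(\<Sum>(n, x)\<in>F. ennreal (exp (- t * real n))) \<le> ennreal (r ^ N / (1 - r))"
        by (simp add: split_beta sum_ennreal)
    qed
    finally show ?thesis .
  qed
  have "(\<lambda>N. r ^ N / (1 - r)) \<longlonglongrightarrow> 0 / (1 - r)"
    using r by (intro tendsto_intros LIMSEQ_realpow_zero) auto
  then have "(\<lambda>N. ennreal (r ^ N / (1 - r))) \<longlonglongrightarrow> ennreal 0"
    by (intro tendsto_ennrealI) simp
  then have "entropy_measure t E \<le> ennreal 0"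
    by (rule LIMSEQ_le[OF entropy_premeasure_tendsto]) (use le in auto)
  then show ?thesis by simp
qed

lemma prob_le_entropy_premeasure:
  assumes F: "F \<in> events" and E: "AE \<omega> in M. \<omega> \<in> E"
    and light: "\<And>\<omega> n. \<omega> \<in> F \<Longrightarrow> N \<le> n \<Longrightarrow> chain_weight p q n \<omega> \<le> exp (- t * real n)"
  shows "ennreal (prob F) \<le> entropy_premeasure t N E"
  unfolding entropy_premeasure_def
proof (rule Inf_greatest, safe)
  fix I :: "nat set" and n :: "nat \<Rightarrow> nat" and x :: "nat \<Rightarrow> nat \<Rightarrow> nat"
  assume I: "\<forall>i\<in>I. N \<le> n i \<and> x i \<in> seq_space" and cover: "E \<subseteq> (\<Union>i\<in>I. cylinder (n i) (x i))"
  define I' where "I' = {i \<in> I. cylinder (n i) (x i) \<inter> F \<noteq> {}}"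
  \<comment> \<open>Padding with empty sets gives a sequence indexed by all naturals, as countable
    subadditivity requires.\<close>
  define C where "C i = (if i \<in> I' then cylinder (n i) (x i) else {})" for i
  have C: "range C \<subseteq> events" using I cylinder_sets by (auto simp: C_def I'_def)
  have C_le: "emeasure M (C i) \<le> ennreal (exp (- t * real (n i)))" if i: "i \<in> I'" for i
  proof -
    obtain \<omega> where \<omega>: "\<omega> \<in> cylinder (n i) (x i)" "\<omega> \<in> F" using i by (auto simp: I'_def)
    have "prob (C i) = chain_weight p q (n i) \<omega>"
      using that I chain_weight_cylinder[OF \<omega>(1)] by (simp add: C_def I'_def cylinder_measure)
    also have "\<dots> \<le> exp (- t * real (n i))" using light[OF \<omega>(2)] I that by (auto simp: I'_def)
    finally show ?thesis by (simp add: emeasure_eq_measure ennreal_leI)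
  qed
  have "ennreal (prob F) = emeasure M F" by (simp add: emeasure_eq_measure)
  \<comment> \<open>The cover is one of \<open>E\<close>, which contains \<open>F\<close> only up to
    a null set.\<close>
  also have "\<dots> \<le> emeasure M (\<Union>i. C i)"
  proof (rule emeasure_mono_AE)
    show "AE \<omega> in M. \<omega> \<in> F \<longrightarrow> \<omega> \<in> (\<Union>i. C i)"
      using E
    proof (rule AE_mp, intro AE_I2 impI)
      fix \<omega> assume "\<omega> \<in> E" "\<omega> \<in> F"
      then obtain i where i: "i \<in> I" "\<omega> \<in> cylinder (n i) (x i)" using cover by blast
      then have "i \<in> I'" using \<open>\<omega> \<in> F\<close> by (auto simp: I'_def)
      then have "\<omega> \<in> C i" using i by (simp add: C_def)
      then show "\<omega> \<in> (\<Union>i. C i)" by blast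
    qed
  qed (use C in auto)
  also have "\<dots> \<le> (\<Sum>i. emeasure M (C i))"
    by (rule emeasure_subadditive_countably[OF C])
  also have "\<dots> \<le> (\<Sum>\<^sub>\<infinity>i\<in>I. ennreal (exp (- t * real (n i))))"
    unfolding suminf_eq_SUP
  proof (rule SUP_least)
    fix m
    have "(\<Sum>i<m. emeasure M (C i)) = (\<Sum>i\<in>{..<m} \<inter> I'. emeasure M (C i))"
      by (rule sum.mono_neutral_right) (auto simp: C_def)
    also have "\<dots> \<le> (\<Sum>i\<in>{..<m} \<inter> I'. ennreal (exp (- t * real (n i))))"
      by (rule sum_mono) (use C_le in auto)
    also have "\<dots> \<le> (\<Sum>\<^sub>\<infinity>i\<in>I. ennreal (exp (- t * real (n i))))"
      by (subst nonneg_infsum_complete, simp, rule SUP_upper) (auto simp: I'_def)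
    finally show "(\<Sum>i<m. emeasure M (C i)) \<le> (\<Sum>\<^sub>\<infinity>i\<in>I. ennreal (exp (- t * real (n i))))" .
  qed
  finally show "ennreal (prob F) \<le> (\<Sum>\<^sub>\<infinity>i\<in>I. ennreal (exp (- t * real (n i))))" .
qed

lemma h_top_ge:
  assumes "E \<subseteq> seq_space" and E: "AE \<omega> in M. \<omega> \<in> E"
    and light: "\<And>s. s < h \<Longrightarrow>
      AE \<omega> in M. \<forall>\<^sub>F n in sequentially. chain_weight p q n \<omega> \<le> exp (- s * real n)"
  shows "h \<le> h_top E"
  unfolding h_top_def
proof (rule cInf_greatest)
  show "{s. 0 \<le> s \<and> entropy_measure s E = 0} \<noteq> {}"
    using entropy_measure_one[OF assms(1)] zero_le_one by blast
  fix t assume "t \<in> {s. 0 \<le> s \<and> entropy_measure s E = 0}"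
  then have t: "entropy_measure t E = 0" by simp
  show "h \<le> t"
  proof (rule ccontr)
    assume "\<not> h \<le> t"
    then have AEt: "AE \<omega> in M. \<forall>\<^sub>F n in sequentially. chain_weight p q n \<omega> \<le> exp (- t * real n)"
      by (intro light) simp
    \<comment> \<open>These sets make the starting length of the bound uniform. They increase to a
      set of full measure, so one of them has positive mass, which the premeasure of
      \<open>E\<close> would then dominate.\<close>
    define F where "F N = {\<omega> \<in> seq_space. \<forall>n\<ge>N. chain_weight p q n \<omega> \<le> exp (- t * real n)}" for N
    have "{\<omega> \<in> seq_space. chain_weight p q n \<omega> \<le> exp (- t * real n)} \<in> events" for n
      by (rule determined_measure(1)[of _ n])
        (use chain_weight_cylinder[of _ n] in \<open>auto dest: cylinder_subset[THEN subsetD]\<close>)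
    then have F: "F N \<in> events" for N
      unfolding F_def space_eq[symmetric]
      by (intro sets.sets_Collect_countable_All sets.sets_Collect_imp) auto
    have "incseq F" unfolding F_def incseq_def by auto
    then have lim: "(\<lambda>N. prob (F N)) \<longlonglongrightarrow> prob (\<Union>N. F N)"
      using F by (intro finite_Lim_measure_incseq) auto
    have "AE \<omega> in M. \<omega> \<in> (\<Union>N. F N)"
      using AEt by (rule AE_mp) (auto simp: F_def space_eq eventually_sequentially intro!: AE_I2)
    then have "prob (\<Union>N. F N) = 1" using F by (intro prob_eq_1[THEN iffD2]) auto
    then obtain N where N: "0 < prob (F N)"
      using order_tendstoD(1)[OF lim, of 0] by (auto simp: eventually_sequentially)
    have "ennreal (prob (F N)) \<le> entropy_premeasure t N E"
      by (rule prob_le_entropy_premeasure[OF F E]) (auto simp: F_def)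
    also have "\<dots> \<le> 0" using entropy_premeasure_le_measure[of t N E] t by simp
    finally show False using N by simp
  qed
qed

end

subsection \<open>Averages of typical sequences\<close>

lemma half_ratio_tendsto: "(\<lambda>n. real (n div 2) / real n) \<longlonglongrightarrow> 1 / 2"
proof (rule LIM_zero_cancel, rule Lim_null_comparison)
  have "\<bar>real (n div 2) / real n - 1 / 2\<bar> \<le> 1 / real n" if "1 \<le> n" for n
  proof -
    have "real n = 2 * real (n div 2) + real (n mod 2)" "real (n mod 2) \<le> 1"
      by (metis mult_div_mod_eq of_nat_add of_nat_mult of_nat_numeral) simp
    then show ?thesis using that by (auto simp: abs_if field_simps)
  qed
  then show "\<forall>\<^sub>F n in sequentially. norm (real (n div 2) / real n - 1 / 2) \<le> 1 / real n"
    unfolding eventually_sequentially real_norm_def by blast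
qed (rule lim_1_over_n)

lemma tendsto_half_index:
  fixes X :: "nat \<Rightarrow> real"
  assumes "(\<lambda>n. X n / real n) \<longlonglongrightarrow> a"
  shows "(\<lambda>n. X (n div 2) / real n) \<longlonglongrightarrow> a / 2"
proof -
  have "filterlim (\<lambda>n. n div 2) at_top (sequentially :: nat filter)"
    unfolding filterlim_at_top eventually_sequentially
    by (metis div_le_mono nonzero_mult_div_cancel_left zero_neq_numeral)
  then have "(\<lambda>n. X (n div 2) / real (n div 2)) \<longlonglongrightarrow> a"
    using filterlim_compose[OF assms] by blast
  then have "(\<lambda>n. X (n div 2) / real (n div 2) * (real (n div 2) / real n)) \<longlonglongrightarrow> a * (1 / 2)"
    by (intro tendsto_mult half_ratio_tendsto)
  then have "(\<lambda>n. X (n div 2) / real (n div 2) * (real (n div 2) / real n)) \<longlonglongrightarrow> a / 2" by simp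
  moreover have "\<forall>\<^sub>F n in sequentially.
      X (n div 2) / real (n div 2) * (real (n div 2) / real n) = X (n div 2) / real n"
    using eventually_ge_at_top[of 2]
  proof eventually_elim
    case (elim n)
    then have "real (n div 2) \<noteq> 0" by (simp add: div_greater_zero_iff)
    then show ?case by simp
  qed
  ultimately show ?thesis by (rule Lim_transform_eventually)
qed

text \<open>Iterating the inequality j times divides the initial bound \<open>B\<close> by 2^j,
  while the errors accumulate only as a geometric series.\<close>

lemma halving_contraction_tendsto:
  fixes e \<delta> :: "nat \<Rightarrow> real"
  assumes step: "\<And>n. 1 \<le> n \<Longrightarrow> e n \<le> e (n div 2) / 2 + \<delta> n"
    and "\<delta> \<longlonglongrightarrow> 0" and nonneg: "\<And>n. 0 \<le> e n" and bounded: "\<And>n. e n \<le> B"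
  shows "e \<longlonglongrightarrow> 0"
proof (rule tendstoI)
  fix \<epsilon> :: real assume \<epsilon>: "0 < \<epsilon>"
  obtain N where N: "\<And>n. N \<le> n \<Longrightarrow> \<delta> n < \<epsilon> / 4"
    using order_tendstoD(2)[OF assms(2), of "\<epsilon> / 4"] \<epsilon> by (auto simp: eventually_sequentially)
  \<comment> \<open>The term \<epsilon> / 2 reproduces itself: half of it plus the error \<epsilon>
    / 4. Using \<open>Suc N\<close> also ensures that \<open>n\<close> is at least 1, so
    \<open>step\<close> applies.\<close>
  have bound: "2 ^ j * Suc N \<le> n \<Longrightarrow> e n \<le> \<epsilon> / 2 + B / 2 ^ j" for j n
  proof (induction j arbitrary: n)
    case 0
    then show ?case using bounded[of n] \<epsilon> by simp
  next
    case (Suc j)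
    have "2 * (2 ^ j * Suc N) \<le> n" using Suc.prems by (simp add: mult.assoc)
    then have "2 ^ j * Suc N \<le> n div 2" by linarith
    then have "e (n div 2) / 2 \<le> (\<epsilon> / 2 + B / 2 ^ j) / 2"
      by (intro divide_right_mono Suc.IH) auto
    also have "\<dots> = \<epsilon> / 4 + B / 2 ^ Suc j" by (simp add: field_simps)
    finally have "e (n div 2) / 2 \<le> \<epsilon> / 4 + B / 2 ^ Suc j" .
    moreover have "Suc N \<le> n"
      using Suc.prems mult_le_mono1[of 1 "2 ^ Suc j" "Suc N"] by (metis le_trans nat_mult_1 one_le_numeral one_le_power)
    then have "e n \<le> e (n div 2) / 2 + \<delta> n" "\<delta> n < \<epsilon> / 4" using step[of n] N[of n] by auto
    ultimately show ?case by linarith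
  qed
  have "(\<lambda>j. B * (1 / 2) ^ j) \<longlonglongrightarrow> B * 0"
    by (intro tendsto_intros LIMSEQ_realpow_zero) auto
  then have "\<forall>\<^sub>F j in sequentially. B * (1 / 2) ^ j < \<epsilon> / 2"
    using \<epsilon> by (intro order_tendstoD(2)) auto
  then obtain j where "B * (1 / 2) ^ j < \<epsilon> / 2" by (auto simp: eventually_sequentially)
  then have j: "B / 2 ^ j < \<epsilon> / 2" by (simp add: power_divide)
  have "e n < \<epsilon>" if "2 ^ j * Suc N \<le> n" for n using bound[OF that] j by linarith
  then show "\<forall>\<^sub>F n in sequentially. dist (e n) 0 < \<epsilon>"
    using nonneg by (auto simp: eventually_sequentially)
qed

lemma ones_count_bounds:
  assumes "\<omega> \<in> seq_space"
  shows "0 \<le> ones_count n \<omega>" "ones_count n \<omega> \<le> real n"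
proof -
  have "ones_count n \<omega> \<le> (\<Sum>k=1..n. 1)"
    unfolding ones_count_def
  proof (rule sum_mono)
    fix k assume "k \<in> {1..n}"
    then show "real (\<omega> k) \<le> 1" using seq_space_values[OF assms, of k] by auto
  qed
  then show "ones_count n \<omega> \<le> real n" by simp
qed (auto simp: ones_count_def intro: sum_nonneg)

lemma freq_set_eq: "freq_set \<theta> = {\<omega> \<in> seq_space. (\<lambda>n. ones_count n \<omega> / real n) \<longlonglongrightarrow> \<theta>}"
  by (simp add: freq_set_def ones_count_def)

lemma mult_avg_set_eq:
  "mult_avg_set \<alpha> = {\<omega> \<in> seq_space. (\<lambda>n. pairs_count n \<omega> / real n) \<longlonglongrightarrow> \<alpha>}"
  by (simp add: mult_avg_set_def pairs_count_def)

text \<open>Up to a vanishing error the frequency \<open>a n\<close> of ones satisfies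
  \<open>a n = p + (q - p) / 2 * a (n div 2)\<close>, a contraction with fixed point \<open>\<theta>\<close>.\<close>

lemma chain_dev_tendsto_imp_averages:
  assumes \<omega>: "\<omega> \<in> seq_space" and p: "p \<in> {0..1}" and q: "q \<in> {0..1}"
    and \<theta>: "\<theta> = p + (q - p) * (\<theta> / 2)"
    and dev1: "(\<lambda>n. chain_dev p q 1 1 n \<omega> / real n) \<longlonglongrightarrow> 0"
    and dev2: "(\<lambda>n. chain_dev p q 1 0 n \<omega> / real n) \<longlonglongrightarrow> 0"
  shows "\<omega> \<in> freq_set \<theta>" and "\<omega> \<in> mult_avg_set (q * \<theta>)"
proof -
  define e where "e n = \<bar>ones_count n \<omega> / real n - \<theta>\<bar>" for n
  define \<delta> where "\<delta> n = \<bar>chain_dev p q 1 1 n \<omega> / real n\<bar> + \<bar>\<theta>\<bar> * \<bar>real (n div 2) / real n - 1 / 2\<bar>" for n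
  have "e \<longlonglongrightarrow> 0"
  proof (rule halving_contraction_tendsto)
    have "(\<lambda>n. \<bar>chain_dev p q 1 1 n \<omega> / real n\<bar>
        + \<bar>\<theta>\<bar> * \<bar>real (n div 2) / real n - 1 / 2\<bar>) \<longlonglongrightarrow> \<bar>0\<bar> + \<bar>\<theta>\<bar> * \<bar>1 / 2 - 1 / 2\<bar>"
      by (intro tendsto_intros dev1 half_ratio_tendsto)
    then show "\<delta> \<longlonglongrightarrow> 0" by (simp add: \<delta>_def[abs_def])
    show "0 \<le> e n" for n by (simp add: e_def)
    show "e n \<le> 1 + \<bar>\<theta>\<bar>" for n
    proof -
      have "0 \<le> ones_count n \<omega> / real n" "ones_count n \<omega> / real n \<le> 1"
        using ones_count_bounds[OF \<omega>, of n] by (auto simp: divide_le_eq_1)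
      then show ?thesis unfolding e_def by linarith
    qed
    fix n :: nat assume n: "1 \<le> n"
    define m where "m = n div 2"
    define x where "x = real m / real n"
    have x: "0 \<le> x" "x \<le> 1 / 2" using n by (auto simp: x_def m_def field_simps)
    \<comment> \<open>For \<open>m = 0\<close> the quotient by \<open>m\<close> is 0 by convention,
      and the count on the left is 0 as well.\<close>
    have om: "ones_count m \<omega> / real n = x * (ones_count m \<omega> / real m)"
    proof (cases "m = 0")
      case True
      then show ?thesis by (simp add: ones_count_def)
    qed (simp add: x_def)
    \<comment> \<open>With \<open>u = v = 1\<close> the pair counts cancel, which leaves a
      recurrence for the ones alone.\<close>
    have "ones_count n \<omega> = chain_dev p q 1 1 n \<omega> + p * real n + (q - p) * ones_count m \<omega>"
      unfolding chain_dev_eq[OF \<omega>] m_def by (simp add: algebra_simps)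
    then have "ones_count n \<omega> / real n
        = chain_dev p q 1 1 n \<omega> / real n + p + (q - p) * (ones_count m \<omega> / real n)"
      using n by (simp add: add_divide_distrib)
    also have "\<dots> = chain_dev p q 1 1 n \<omega> / real n + p + (q - p) * (x * (ones_count m \<omega> / real m))"
      by (simp only: om)
    finally have "ones_count n \<omega> / real n - \<theta> = chain_dev p q 1 1 n \<omega> / real n
        + (q - p) * (x * (ones_count m \<omega> / real m - \<theta>) + \<theta> * (x - 1 / 2))"
      using \<theta> by (simp add: algebra_simps)
    then have "e n \<le> \<bar>chain_dev p q 1 1 n \<omega> / real n\<bar>
        + \<bar>q - p\<bar> * \<bar>x * (ones_count m \<omega> / real m - \<theta>) + \<theta> * (x - 1 / 2)\<bar>"
      unfolding e_def by (metis abs_mult abs_triangle_ineq)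
    also have "\<bar>q - p\<bar> * \<bar>x * (ones_count m \<omega> / real m - \<theta>) + \<theta> * (x - 1 / 2)\<bar>
        \<le> 1 * (\<bar>x * (ones_count m \<omega> / real m - \<theta>)\<bar> + \<bar>\<theta> * (x - 1 / 2)\<bar>)"
      using p q by (intro mult_mono abs_triangle_ineq) auto
    also have "\<bar>x * (ones_count m \<omega> / real m - \<theta>)\<bar> \<le> 1 / 2 * e m"
      unfolding abs_mult e_def by (intro mult_mono) (use x in auto)
    finally show "e n \<le> e (n div 2) / 2 + \<delta> n"
      by (simp add: \<delta>_def m_def x_def abs_mult)
  qed
  then have freq: "(\<lambda>n. ones_count n \<omega> / real n) \<longlonglongrightarrow> \<theta>"
    unfolding e_def by (rule LIM_zero_cancel[OF tendsto_rabs_zero_cancel])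
  then show "\<omega> \<in> freq_set \<theta>" using \<omega> by (simp add: freq_set_eq)
  \<comment> \<open>With \<open>u = 1\<close>, \<open>v = 0\<close> the deviation at 2n is
    \<open>pairs_count n \<omega> - q * ones_count n \<omega>\<close>; doubling the index reaches
    the pair counts at every \<open>n\<close>.\<close>
  have "filterlim (\<lambda>n::nat. 2 * n) at_top sequentially"
    by (rule filterlim_subseq) (simp add: strict_mono_def)
  then have "(\<lambda>n. chain_dev p q 1 0 (2 * n) \<omega> / real (2 * n)) \<longlonglongrightarrow> 0"
    by (rule filterlim_compose[OF dev2])
  then have "(\<lambda>n. 2 * (chain_dev p q 1 0 (2 * n) \<omega> / real (2 * n))
      + q * (ones_count n \<omega> / real n)) \<longlonglongrightarrow> 2 * 0 + q * \<theta>"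
    by (intro tendsto_intros freq)
  moreover have "2 * (chain_dev p q 1 0 (2 * n) \<omega> / real (2 * n)) + q * (ones_count n \<omega> / real n)
      = pairs_count n \<omega> / real n" for n
    unfolding chain_dev_eq[OF \<omega>] by (cases "n = 0") (auto simp: field_simps)
  ultimately show "\<omega> \<in> mult_avg_set (q * \<theta>)" using \<omega> by (simp add: mult_avg_set_eq)
qed

subsection \<open>The entropy formula\<close>

text \<open>The limit of the expression in \<open>ln_chain_weight\<close> divided by
  \<open>n\<close>, for a point with averages \<theta> and \<alpha>; its negative is the local
  entropy there.\<close>

definition chain_log_rate :: "real \<Rightarrow> real \<Rightarrow> real \<Rightarrow> real \<Rightarrow> real" where
  "chain_log_rate \<alpha> \<theta> p q = \<alpha> / 2 * ln q + (\<theta> / 2 - \<alpha> / 2) * ln (1 - q)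
     + (\<theta> - \<alpha> / 2) * ln p + (1 - \<theta> / 2 - \<theta> + \<alpha> / 2) * ln (1 - p)"

lemma ln_chain_weight_tendsto:
  assumes \<omega>: "\<omega> \<in> freq_set \<theta> \<inter> mult_avg_set \<alpha>" and pos: "\<And>n. 0 < chain_weight p q n \<omega>"
  shows "(\<lambda>n. ln (chain_weight p q n \<omega>) / real n) \<longlonglongrightarrow> chain_log_rate \<alpha> \<theta> p q"
proof -
  have sp: "\<omega> \<in> seq_space" and S: "(\<lambda>n. ones_count n \<omega> / real n) \<longlonglongrightarrow> \<theta>"
    and P: "(\<lambda>n. pairs_count n \<omega> / real n) \<longlonglongrightarrow> \<alpha>"
    using \<omega> by (auto simp: freq_set_eq mult_avg_set_eq)
  note S' = tendsto_half_index[OF S] and P' = tendsto_half_index[OF P]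
  have "(\<lambda>n. pairs_count (n div 2) \<omega> / real n * ln q
      + (ones_count (n div 2) \<omega> / real n - pairs_count (n div 2) \<omega> / real n) * ln (1 - q)
      + (ones_count n \<omega> / real n - pairs_count (n div 2) \<omega> / real n) * ln p
      + (1 - ones_count (n div 2) \<omega> / real n - ones_count n \<omega> / real n
          + pairs_count (n div 2) \<omega> / real n) * ln (1 - p)) \<longlonglongrightarrow> chain_log_rate \<alpha> \<theta> p q"
    unfolding chain_log_rate_def by (intro tendsto_intros S P S' P')
  moreover have "\<forall>\<^sub>F n in sequentially.
      pairs_count (n div 2) \<omega> / real n * ln q
      + (ones_count (n div 2) \<omega> / real n - pairs_count (n div 2) \<omega> / real n) * ln (1 - q)
      + (ones_count n \<omega> / real n - pairs_count (n div 2) \<omega> / real n) * ln p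
      + (1 - ones_count (n div 2) \<omega> / real n - ones_count n \<omega> / real n
          + pairs_count (n div 2) \<omega> / real n) * ln (1 - p)
      = ln (chain_weight p q n \<omega>) / real n"
    using eventually_gt_at_top[of 0]
    by eventually_elim (simp add: ln_chain_weight[OF sp pos] field_simps)
  ultimately show ?thesis by (rule Lim_transform_eventually)
qed

text \<open>Here and for boundary values of \<open>p\<close> and \<open>q\<close>, \<open>ln 0 = 0\<close> encodes the convention
  \<open>0 log 0 = 0\<close>.\<close>

lemma bin_entropy_eq: "bin_entropy x = - (x * ln x + (1 - x) * ln (1 - x))"
  by (auto simp: bin_entropy_def)

lemma bin_entropy_nonneg:
  assumes "x \<in> {0..1}"
  shows "0 \<le> bin_entropy x"
proof -
  have "x * ln x \<le> 0" "(1 - x) * ln (1 - x) \<le> 0"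
    using assms ln_le_zero_iff[of x] ln_le_zero_iff[of "1 - x"]
    by (cases "x = 0"; cases "x = 1"; simp add: mult_le_0_iff)+
  then show ?thesis by (simp add: bin_entropy_eq)
qed

text \<open>The cross entropy of x against y attains the entropy at y = x. If x is 0 or 1, then y is
  moved slightly inside the interval by continuity of ln at 1, so that no cylinder gets weight
  zero.\<close>

lemma cross_entropy_approx:
  fixes m x \<epsilon> :: real
  assumes "0 \<le> m" "x \<in> {0..1}" "0 < \<epsilon>"
  shows "\<exists>y. 0 < y \<and> y < 1 \<and> - (m * x * ln y + m * (1 - x) * ln (1 - y)) < m * bin_entropy x + \<epsilon>"
proof -
  have small: "\<exists>y. 0 < y \<and> y < 1 \<and> - (m * ln (1 - y)) < \<epsilon>"
  proof -
    have "((\<lambda>y. - (m * ln (1 - y))) \<longlongrightarrow> - (m * ln (1 - 0))) (at_right 0)"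
      by (intro tendsto_intros) auto
    then have "\<forall>\<^sub>F y in at_right 0. - (m * ln (1 - y)) < \<epsilon>"
      using assms by (intro order_tendstoD(2)) auto
    moreover have "\<forall>\<^sub>F y in at_right 0. y < (1::real)"
      by (rule eventually_at_rightI[of 0 1]) auto
    moreover have "\<forall>\<^sub>F y in at_right 0. 0 < (y::real)" by (rule eventually_at_right_less)
    ultimately have "\<forall>\<^sub>F y in at_right 0. 0 < y \<and> y < 1 \<and> - (m * ln (1 - y)) < \<epsilon>"
      by eventually_elim auto
    then show ?thesis by (rule eventually_happens'[rotated]) simp
  qed
  consider "x = 0" | "x = 1" | "0 < x" "x < 1" using assms(2) by fastforce
  then show ?thesis
  proof cases
    case 1
    with small show ?thesis by (simp add: bin_entropy_def)
  next
    case 2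
    obtain y where "0 < y" "y < 1" "- (m * ln (1 - y)) < \<epsilon>" using small by blast
    then show ?thesis using 2 by (intro exI[of _ "1 - y"]) (simp add: bin_entropy_def)
  next
    case 3
    then show ?thesis using assms
      by (intro exI[of _ x]) (simp add: bin_entropy_eq algebra_simps)
  qed
qed

lemma chain_weight_pos:
  assumes "0 < p" "p < 1" "0 < q" "q < 1"
  shows "0 < chain_weight p q n \<omega>"
  unfolding chain_weight_def by (rule prod_pos) (use assms in \<open>auto simp: chain_prob_def\<close>)

text \<open>The mean conditional entropy per index: a proportion \<open>\<theta> / 2\<close> of the
  indices follows a one and uses \<open>q = \<alpha> / \<theta>\<close>, the others use
  \<open>p\<close>.\<close>

definition pair_entropy :: "real \<Rightarrow> real \<Rightarrow> real" where
  "pair_entropy \<alpha> \<theta> = (1 - \<theta> / 2) * bin_entropy ((2 * \<theta> - \<alpha>) / (2 - \<theta>))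
     + \<theta> / 2 * bin_entropy (\<alpha> / \<theta>)"

section \<open>Both entropy bounds at the optimal parameters\<close>

context
  fixes \<alpha> \<theta> p q :: real
  assumes \<alpha>: "0 \<le> \<alpha>" "\<alpha> \<le> \<theta>" and \<theta>: "\<theta> \<le> 1" "\<theta> \<le> (2 + \<alpha>) / 3"
    and p_def: "p = (2 * \<theta> - \<alpha>) / (2 - \<theta>)" and q_def: "q = \<alpha> / \<theta>"
begin

text \<open>The upper bound on \<theta> by (2 + \<alpha>) / 3 is exactly \<open>p \<le> 1\<close>,
  and \<open>\<alpha> \<le> \<theta>\<close> gives \<open>q \<le> 1\<close>. The two identities
  balance densities of ones: \<open>\<alpha> / 2\<close> after a one, the remaining
  \<open>\<theta> - \<alpha> / 2\<close> elsewhere. For \<open>\<theta> = 0\<close> also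
  \<open>\<alpha> = 0\<close>, and \<open>q\<close> is 0.\<close>

lemma chain_params:
  "p \<in> {0..1}" "q \<in> {0..1}" "q * \<theta> = \<alpha>" "p * (1 - \<theta> / 2) = \<theta> - \<alpha> / 2"
proof -
  have "0 < 2 - \<theta>" using \<theta> by simp
  then show "p \<in> {0..1}" "p * (1 - \<theta> / 2) = \<theta> - \<alpha> / 2"
    using \<alpha> \<theta> by (simp_all add: p_def field_simps)
  show "q \<in> {0..1}" "q * \<theta> = \<alpha>"
    using \<alpha> by (auto simp: q_def divide_le_eq_1)
qed

lemma pair_entropy_nonneg: "0 \<le> pair_entropy \<alpha> \<theta>"
  unfolding pair_entropy_def p_def[symmetric] q_def[symmetric]
  using chain_params(1,2) \<alpha> \<theta> by (intro add_nonneg_nonneg mult_nonneg_nonneg bin_entropy_nonneg) auto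

text \<open>Splits the rate into cross entropies of \<open>q\<close> against \<open>q'\<close> and
  of \<open>p\<close> against \<open>p'\<close>, so that the two can be optimised
  separately.\<close>

lemma chain_log_rate_eq:
  "chain_log_rate \<alpha> \<theta> p' q' =
     \<theta> / 2 * q * ln q' + \<theta> / 2 * (1 - q) * ln (1 - q')
   + ((1 - \<theta> / 2) * p * ln p' + (1 - \<theta> / 2) * (1 - p) * ln (1 - p'))"
proof -
  have a: "\<alpha> / 2 = \<theta> / 2 * q" and b: "\<theta> - \<alpha> / 2 = (1 - \<theta> / 2) * p"
    using chain_params(3,4) by (simp_all add: mult.commute)
  have "\<theta> / 2 - \<alpha> / 2 = \<theta> / 2 * (1 - q)"
    "1 - \<theta> / 2 - \<theta> + \<alpha> / 2 = (1 - \<theta> / 2) * (1 - p)"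
    unfolding right_diff_distrib a[symmetric] b[symmetric] by simp_all
  note this a b
  then show ?thesis unfolding chain_log_rate_def by (simp only: ac_simps)
qed

lemma h_top_le_pair_entropy:
  assumes E: "E \<subseteq> freq_set \<theta> \<inter> mult_avg_set \<alpha>"
  shows "h_top E \<le> pair_entropy \<alpha> \<theta>"
proof (rule field_le_epsilon)
  fix \<epsilon> :: real assume \<epsilon>: "0 < \<epsilon>"
  define t where "t = pair_entropy \<alpha> \<theta> + \<epsilon>"
  obtain p' where p': "0 < p'" "p' < 1"
    "- ((1 - \<theta> / 2) * p * ln p' + (1 - \<theta> / 2) * (1 - p) * ln (1 - p')) < (1 - \<theta> / 2) * bin_entropy p + \<epsilon> / 2"
    using cross_entropy_approx[of "1 - \<theta> / 2" p "\<epsilon> / 2"] chain_params \<theta> \<epsilon> by auto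
  obtain q' where q': "0 < q'" "q' < 1"
    "- (\<theta> / 2 * q * ln q' + \<theta> / 2 * (1 - q) * ln (1 - q')) < \<theta> / 2 * bin_entropy q + \<epsilon> / 2"
    using cross_entropy_approx[of "\<theta> / 2" q "\<epsilon> / 2"] chain_params \<alpha> \<epsilon> by auto
  have "- chain_log_rate \<alpha> \<theta> p' q' < t"
    using p'(3) q'(3) unfolding chain_log_rate_eq t_def pair_entropy_def
      p_def[symmetric] q_def[symmetric] by linarith
  then obtain s where s: "- chain_log_rate \<alpha> \<theta> p' q' < s" "s < t" using dense by blast
  have "\<exists>M. chain_measure M p' q'" using p' q' by (intro chain_measure_exists) auto
  then obtain M where "chain_measure M p' q'" by blast
  then interpret chain_measure M p' q' .
  have "entropy_measure t E = 0"
  proof (rule entropy_measure_eq_0[OF _ s(2)])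
    show "E \<subseteq> seq_space" using E by (auto simp: freq_set_def)
    fix \<omega> assume "\<omega> \<in> E"
    have pos: "0 < chain_weight p' q' n \<omega>" for n using p' q' by (intro chain_weight_pos)
    have "\<forall>\<^sub>F n in sequentially. - s < ln (chain_weight p' q' n \<omega>) / real n"
      using s(1) \<open>\<omega> \<in> E\<close> E pos by (intro order_tendstoD(1)[OF ln_chain_weight_tendsto]) auto
    then show "\<forall>\<^sub>F n in sequentially. exp (- s * real n) \<le> chain_weight p' q' n \<omega>"
      using eventually_gt_at_top[of 0]
    proof eventually_elim
      case (elim n)
      then have "- s * real n \<le> ln (chain_weight p' q' n \<omega>)" by (simp add: field_simps)
      then show ?case using pos[of n] by (simp add: ln_ge_iff)
    qed
  qed
  \<comment> \<open>The infimum defining \<open>h_top\<close> ranges over nonnegative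
    exponents.\<close>
  moreover have "0 \<le> t" using pair_entropy_nonneg \<epsilon> by (simp add: t_def)
  ultimately have "h_top E \<le> t"
    unfolding h_top_def by (intro cInf_lower bdd_belowI[of _ 0]) auto
  then show "h_top E \<le> pair_entropy \<alpha> \<theta> + \<epsilon>" by (simp add: t_def)
qed

text \<open>The measure with the optimal parameters is carried by the points with the right averages
  all of whose prefixes have positive weight. Requiring only these points in \<open>E\<close> lets
  the bound cover the golden set too.\<close>

lemma pair_entropy_le_h_top:
  assumes E: "E \<subseteq> seq_space"
    and support: "\<And>\<omega>. \<omega> \<in> freq_set \<theta> \<inter> mult_avg_set \<alpha> \<Longrightarrow> (\<And>n. 0 < chain_weight p q n \<omega>) \<Longrightarrow> \<omega> \<in> E"
  shows "pair_entropy \<alpha> \<theta> \<le> h_top E"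
proof -
  obtain M where "chain_measure M p q" using chain_measure_exists chain_params by blast
  then interpret chain_measure M p q .
  \<comment> \<open>Adding the two density balances gives the fixed point equation for the frequency
    of ones.\<close>
  have fp: "\<theta> = p + (q - p) * (\<theta> / 2)" using chain_params(3,4) by (simp add: field_simps)
  have ent: "pair_entropy \<alpha> \<theta> = - chain_log_rate \<alpha> \<theta> p q"
    unfolding chain_log_rate_eq pair_entropy_def p_def[symmetric] q_def[symmetric] bin_entropy_eq
    by (simp add: ring_distribs mult.assoc)
  have "AE \<omega> in M. (\<lambda>n. chain_dev p q 1 1 n \<omega> / real n) \<longlonglongrightarrow> 0"
    "AE \<omega> in M. (\<lambda>n. chain_dev p q 1 0 n \<omega> / real n) \<longlonglongrightarrow> 0"
    by (intro AE_chain_dev_tendsto; simp)+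
  then have AE: "AE \<omega> in M. \<omega> \<in> freq_set \<theta> \<inter> mult_avg_set \<alpha> \<and> (\<forall>n. 0 < chain_weight p q n \<omega>)"
    using AE_chain_weight_pos AE_space
  proof eventually_elim
    case (elim \<omega>)
    then show ?case
      using chain_dev_tendsto_imp_averages[OF _ p01 q01 fp, of \<omega>] chain_params(3)
      by (simp add: space_eq)
  qed
  show ?thesis
  proof (rule h_top_ge[OF E])
    show "AE \<omega> in M. \<omega> \<in> E" using AE by eventually_elim (use support in blast)
    fix s assume s: "s < pair_entropy \<alpha> \<theta>"
    show "AE \<omega> in M. \<forall>\<^sub>F n in sequentially. chain_weight p q n \<omega> \<le> exp (- s * real n)"
      using AE
    proof eventually_elim
      case (elim \<omega>)
      then have "\<forall>\<^sub>F n in sequentially. ln (chain_weight p q n \<omega>) / real n < - s"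
        using s ent by (intro order_tendstoD(2)[OF ln_chain_weight_tendsto]) auto
      then show ?case using eventually_gt_at_top[of 0]
      proof eventually_elim
        case (elim n)
        then have "ln (chain_weight p q n \<omega>) \<le> - s * real n" by (simp add: field_simps)
        then show ?case
          using \<open>\<omega> \<in> _ \<and> (\<forall>n. 0 < chain_weight p q n \<omega>)\<close> by (metis exp_le_cancel_iff exp_ln)
      qed
    qed
  qed
qed

lemma h_top_eq_pair_entropy:
  assumes E: "E \<subseteq> freq_set \<theta> \<inter> mult_avg_set \<alpha>"
    and "\<And>\<omega>. \<omega> \<in> freq_set \<theta> \<inter> mult_avg_set \<alpha> \<Longrightarrow> (\<And>n. 0 < chain_weight p q n \<omega>) \<Longrightarrow> \<omega> \<in> E"
  shows "h_top E = pair_entropy \<alpha> \<theta>"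
proof (rule antisym[OF h_top_le_pair_entropy[OF E] pair_entropy_le_h_top])
  show "E \<subseteq> seq_space" using E by (auto simp: freq_set_def)
qed (use assms(2) in blast)

end

text \<open>The first bound is termwise. For the second, an index after a one carries either a pair
  or a zero, so the zeros up to \<open>n\<close> number at least the ones minus the pairs up to
  \<open>n div 2\<close>.\<close>

lemma averages_bounds:
  assumes \<omega>: "\<omega> \<in> freq_set \<theta> \<inter> mult_avg_set \<alpha>"
  shows "\<alpha> \<le> \<theta>" and "\<theta> \<le> (2 + \<alpha>) / 3"
proof -
  have sp: "\<omega> \<in> seq_space" and S: "(\<lambda>n. ones_count n \<omega> / real n) \<longlonglongrightarrow> \<theta>"
    and P: "(\<lambda>n. pairs_count n \<omega> / real n) \<longlonglongrightarrow> \<alpha>"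
    using \<omega> by (auto simp: freq_set_eq mult_avg_set_eq)
  have "pairs_count n \<omega> \<le> ones_count n \<omega>" for n
    unfolding pairs_count_def ones_count_def
  proof (rule sum_mono)
    fix k assume "k \<in> {1..n}"
    then show "real (\<omega> k * \<omega> (2 * k)) \<le> real (\<omega> k)"
      using seq_space_values[OF sp, of "2 * k"] by auto
  qed
  then have "\<forall>n. pairs_count n \<omega> / real n \<le> ones_count n \<omega> / real n"
    by (simp add: divide_right_mono)
  then show "\<alpha> \<le> \<theta>" by (intro LIMSEQ_le[OF P S]) auto
  have le: "ones_count n \<omega> \<le> real n + pairs_count (n div 2) \<omega> - ones_count (n div 2) \<omega>" for n
  proof -
    have "ones_count n \<omega> \<le> (\<Sum>k=1..n. 1 + of_bool (one_before \<omega> k) * real (\<omega> k) - of_bool (one_before \<omega> k))"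
      unfolding ones_count_def
    proof (rule sum_mono)
      fix k assume "k \<in> {1..n}"
      then show "real (\<omega> k) \<le> 1 + of_bool (one_before \<omega> k) * real (\<omega> k) - of_bool (one_before \<omega> k)"
        using seq_space_values[OF sp, of k] by auto
    qed
    also have "\<dots> = real n + pairs_count (n div 2) \<omega> - ones_count (n div 2) \<omega>"
      unfolding sum_one_before[OF sp, symmetric] sum_one_before_mult[OF sp, symmetric]
      by (simp only: sum.distrib sum_subtractf) simp
    finally show ?thesis .
  qed
  have "\<theta> \<le> 1 + \<alpha> / 2 - \<theta> / 2"
  proof (rule LIMSEQ_le[OF S])
    show "(\<lambda>n. 1 + pairs_count (n div 2) \<omega> / real n - ones_count (n div 2) \<omega> / real n)
        \<longlonglongrightarrow> 1 + \<alpha> / 2 - \<theta> / 2"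
      by (intro tendsto_intros tendsto_half_index S P)
    have "ones_count n \<omega> / real n
        \<le> 1 + pairs_count (n div 2) \<omega> / real n - ones_count (n div 2) \<omega> / real n" if "1 \<le> n" for n
      using divide_right_mono[OF le[of n], of "real n"] that
      by (simp add: add_divide_distrib diff_divide_distrib)
    then show "\<exists>N. \<forall>n\<ge>N. ones_count n \<omega> / real n
        \<le> 1 + pairs_count (n div 2) \<omega> / real n - ones_count (n div 2) \<omega> / real n" by blast
  qed
  then show "\<theta> \<le> (2 + \<alpha>) / 3" by simp
qed

section \<open>The golden set and the final formulas\<close>

lemma mult_golden_subset: "mult_golden_set \<subseteq> mult_avg_set 0"
proof
  fix \<omega> assume \<omega>: "\<omega> \<in> mult_golden_set"
  then have "(\<Sum>k=1..n. real (\<omega> k * \<omega> (2 * k))) = 0" for n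
    by (intro sum.neutral) (auto simp: mult_golden_set_def)
  then show "\<omega> \<in> mult_avg_set 0"
    using \<omega> by (simp add: mult_golden_set_def mult_avg_set_def)
qed

text \<open>Ones at both k and 2k would contribute the factor q = 0 at index 2k.\<close>

lemma chain_weight_pos_imp_golden:
  assumes \<omega>: "\<omega> \<in> seq_space" and pos: "\<And>n. 0 < chain_weight p 0 n \<omega>"
  shows "\<omega> \<in> mult_golden_set"
proof -
  have "\<omega> k * \<omega> (2 * k) = 0" if "1 \<le> k" for k
  proof (rule ccontr)
    assume "\<omega> k * \<omega> (2 * k) \<noteq> 0"
    then have "\<omega> k = 1" "\<omega> (2 * k) = 1"
      using seq_space_values[OF \<omega>, of k] seq_space_values[OF \<omega>, of "2 * k"] that by auto
    then have "chain_weight p 0 (2 * k) \<omega> = 0"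
      unfolding chain_weight_def using that
      by (intro prod_zero bexI[of _ "2 * k"]) (auto simp: chain_prob_def one_before_def)
    then show False using pos[of "2 * k"] by simp
  qed
  then show ?thesis using \<omega> by (simp add: mult_golden_set_def)
qed

theorem theorem1p4:
  fixes \<alpha> \<theta> :: real
  assumes "\<alpha> \<in> {0..1}" and "\<theta> \<in> {0..1}"
  shows "(\<alpha> \<le> \<theta> \<and> \<theta> \<le> (2 + \<alpha>) / 3 \<longrightarrow>
            h_top (freq_set \<theta> \<inter> mult_avg_set \<alpha>) =
              (1 - \<theta> / 2) * bin_entropy ((2 * \<theta> - \<alpha>) / (2 - \<theta>)) +
              (if \<theta> = 0 then 0 else \<theta> / 2 * bin_entropy ((\<theta> - \<alpha>) / \<theta>)))
       \<and> (\<not> (\<alpha> \<le> \<theta> \<and> \<theta> \<le> (2 + \<alpha>) / 3) \<longrightarrow> freq_set \<theta> \<inter> mult_avg_set \<alpha> = {})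
       \<and> (\<theta> \<le> 2 / 3 \<longrightarrow>
            h_top (freq_set \<theta> \<inter> mult_golden_set) = h_top (freq_set \<theta> \<inter> mult_avg_set 0)
          \<and> h_top (freq_set \<theta> \<inter> mult_avg_set 0) =
              (2 - \<theta>) / 2 * bin_entropy (2 * \<theta> / (2 - \<theta>)))"
proof (intro conjI impI)
  assume *: "\<alpha> \<le> \<theta> \<and> \<theta> \<le> (2 + \<alpha>) / 3"
  have "h_top (freq_set \<theta> \<inter> mult_avg_set \<alpha>) = pair_entropy \<alpha> \<theta>"
    using * assms by (intro h_top_eq_pair_entropy) auto
  \<comment> \<open>Symmetry of the entropy under x -> 1 - x; for \<open>\<theta> = 0\<close> the
    prefactor vanishes.\<close>
  also have "\<theta> / 2 * bin_entropy (\<alpha> / \<theta>)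
      = (if \<theta> = 0 then 0 else \<theta> / 2 * bin_entropy ((\<theta> - \<alpha>) / \<theta>))"
    by (simp add: bin_entropy_eq diff_divide_distrib)
  then have "pair_entropy \<alpha> \<theta> = (1 - \<theta> / 2) * bin_entropy ((2 * \<theta> - \<alpha>) / (2 - \<theta>)) +
      (if \<theta> = 0 then 0 else \<theta> / 2 * bin_entropy ((\<theta> - \<alpha>) / \<theta>))"
    by (simp only: pair_entropy_def)
  finally show "h_top (freq_set \<theta> \<inter> mult_avg_set \<alpha>) =
      (1 - \<theta> / 2) * bin_entropy ((2 * \<theta> - \<alpha>) / (2 - \<theta>)) +
      (if \<theta> = 0 then 0 else \<theta> / 2 * bin_entropy ((\<theta> - \<alpha>) / \<theta>))" .
next
  assume "\<not> (\<alpha> \<le> \<theta> \<and> \<theta> \<le> (2 + \<alpha>) / 3)"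
  then show "freq_set \<theta> \<inter> mult_avg_set \<alpha> = {}" using averages_bounds by blast
next
  assume *: "\<theta> \<le> 2 / 3"
  have avg: "h_top (freq_set \<theta> \<inter> mult_avg_set 0) = pair_entropy 0 \<theta>"
    using * assms by (intro h_top_eq_pair_entropy) auto
  have "h_top (freq_set \<theta> \<inter> mult_golden_set) = pair_entropy 0 \<theta>"
  proof (rule h_top_eq_pair_entropy)
    fix \<omega> assume \<omega>: "\<omega> \<in> freq_set \<theta> \<inter> mult_avg_set 0"
      and pos: "\<And>n. 0 < chain_weight ((2 * \<theta> - 0) / (2 - \<theta>)) (0 / \<theta>) n \<omega>"
    \<comment> \<open>The parameter \<open>0 / \<theta>\<close> is 0 for every \<theta>, including
      0.\<close>
    then show "\<omega> \<in> freq_set \<theta> \<inter> mult_golden_set"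
      using chain_weight_pos_imp_golden[of \<omega> "2 * \<theta> / (2 - \<theta>)"] by (auto simp: freq_set_def)
  qed (use * assms mult_golden_subset in auto)
  with avg show "h_top (freq_set \<theta> \<inter> mult_golden_set) = h_top (freq_set \<theta> \<inter> mult_avg_set 0)"
    by simp
  show "h_top (freq_set \<theta> \<inter> mult_avg_set 0) = (2 - \<theta>) / 2 * bin_entropy (2 * \<theta> / (2 - \<theta>))"
    by (simp add: avg pair_entropy_def bin_entropy_def diff_divide_distrib)
qed

end
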